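(* (Noncommutative Laurent Phenomenon.) Let $\Delta$ be a triangulation of $[n]$. Then for all $i,j\in[n]$, $i\ne j$, one has in ${\mathcal A}_n$: $$x_{ij}=\sum_{\mathbf i\in Adm_\Delta(i,j)} x_{\mathbf i}.$$
   Context: Let $n\ge 3$ and $[n]=\{1,\dots,n\}$, viewed as the vertices of a convex $n$-gon in cyclic order; a pair $(i,j)$ with $i\neq j$ is viewed as the directed chord from $i$ to $j$. A sequence of distinct elements of $[n]$ is cyclic if some cyclic rotation of it is strictly increasing. ${\mathcal A}_n$ is the $\mathbb{Q}$-algebra generated by $x_{ij}$ and $x_{ij}^{-1}$, $i,j\in[n]$, $i\ne j$, subject to: (i) (triangle relations) $x_{ij}x_{kj}^{-1}x_{ki}=x_{ik}x_{jk}^{-1}x_{ji}$ for all distinct $i,j,k$; (ii) (exchange relations) $x_{j\ell}=x_{jk}x_{ik}^{-1}x_{i\ell}+x_{ji}x_{ki}^{-1}x_{k\ell}$ for all cyclic $(i,j,k,\ell)$. The chord $(i,k)$ crosses $(j,\ell)$ if $(i,j,k,\ell)$ is cyclic. A triangulation $\Delta$ of $[n]$ is a maximal crossing-free subset of $[n]\times[n]\setminus\{(i,i)\}$ (so it contains each of its chords in both directions, and all sides). For a sequence $\mathbf i=(i_1,\dots,i_{2m})\in[n]^{2m}$ with distinct adjacent entries put $x_{\mathbf i}:=x_{i_1,i_2}x_{i_3,i_2}^{-1}x_{i_3,i_4}\cdots x_{i_{2m-1},i_{2m-2}}^{-1}x_{i_{2m-1},i_{2m}}$. A sequence $\mathbf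 i=(i_1,\dots,i_{2m})\in[n]^{2m}$ is $(i,j,\Delta)$-admissible if: (i) $i_1=i$, $i_{2m}=j$ and $(i_s,i_{s+1})\in\Delta$ for $s=1,\dots,2m-1$; (ii) each chord $(i_{2s},i_{2s+1})$, $s=1,\dots,m-1$, intersects $(i,j)$; (iii) if $\mathbf p:=(i_k,i_{k+1})\cap(i,j)\neq\emptyset$ and $\mathbf q:=(i_\ell,i_{\ell+1})\cap(i,j)\ne\emptyset$ for some $k<\ell$, then the point $\mathbf p$ of $(i,j)$ is closer to $i$ along $(i,j)$ than the point $\mathbf q$. $Adm_\Delta(i,j)$ denotes the set of all $(i,j,\Delta)$-admissible sequences. *)

theory Defs
  imports "HOL-Algebra.QuotRing" "HOL-Analysis.Line_Segment"
begin

section \<open>The free associative \<open>\<rat>\<close>-algebra on a set of symbols\<close>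

text \<open>Elements are finitely supported rational functions on words; multiplication is the
  convolution over all ways of cutting a word into a prefix and a suffix.\<close>

definition free_algebra :: "'g set \<Rightarrow> ('g list \<Rightarrow> rat) ring" where
  "free_algebra G =
    \<lparr>carrier = {f. finite {w. f w \<noteq> 0} \<and> {w. f w \<noteq> 0} \<subseteq> lists G},
     monoid.mult = (\<lambda>f g w. \<Sum>k\<le>length w. f (take k w) * g (drop k w)),
     one = (\<lambda>w. if w = [] then 1 else 0),
     zero = (\<lambda>w. 0),
     add = (\<lambda>f g w. f w + g w)\<rparr>"

definition monomial :: "'g list \<Rightarrow> 'g list \<Rightarrow> rat" where
  "monomial u = (\<lambda>w. if w = u then 1 else 0)"

lemma conv_assoc:
  fixes f g h :: "'g list \<Rightarrow> rat"
  shows "(\<Sum>k\<le>length w. (\<Sum>j\<le>length (take k w). f (take j (take k w)) * g (drop j (take k w)))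
            * h (drop k w))
       = (\<Sum>j\<le>length w. f (take j w) *
            (\<Sum>l\<le>length (drop j w). g (take l (drop j w)) * h (drop l (drop j w))))"
proof -
  let ?n = "length w"
  have "(\<Sum>k\<le>?n. (\<Sum>j\<le>length (take k w). f (take j (take k w)) * g (drop j (take k w))) * h (drop k w))
      = (\<Sum>k\<le>?n. \<Sum>j\<le>k. f (take j w) * g (drop j (take k w)) * h (drop k w))"
    by (intro sum.cong refl) (auto simp: sum_distrib_right min_def intro!: sum.cong)
  also have "\<dots> = (\<Sum>(k, j)\<in>(SIGMA k:{..?n}. {..k}). f (take j w) * g (drop j (take k w)) * h (drop k w))"
    by (simp add: sum.Sigma)
  also have "\<dots> = (\<Sum>(j, l)\<in>(SIGMA j:{..?n}. {..?n - j}).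
                    f (take j w) * (g (take l (drop j w)) * h (drop l (drop j w))))"
    by (rule sum.reindex_bij_witness[where i = "\<lambda>(j, l). (j + l, j)" and j = "\<lambda>(k, j). (j, k - j)"])
       (auto simp: drop_take algebra_simps)
  also have "\<dots> = (\<Sum>j\<le>?n. f (take j w) *
            (\<Sum>l\<le>length (drop j w). g (take l (drop j w)) * h (drop l (drop j w))))"
    by (simp add: sum.Sigma[symmetric] sum_distrib_left)
  finally show ?thesis .
qed

lemma ring_free_algebra: "ring (free_algebra G)"
proof (rule ringI)
  let ?R = "free_algebra G"
  show "abelian_group ?R"
  proof (rule abelian_groupI)
    fix x y assume xy: "x \<in> carrier ?R" "y \<in> carrier ?R"
    have sub: "{w. x w + y w \<noteq> 0} \<subseteq> {w. x w \<noteq> 0} \<union> {w. y w \<noteq> 0}" by auto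
    have "finite {w. x w + y w \<noteq> 0}"
      using xy by (intro finite_subset[OF sub]) (auto simp: free_algebra_def)
    with sub xy show "x \<oplus>\<^bsub>?R\<^esub> y \<in> carrier ?R"
      unfolding free_algebra_def by auto
  next
    fix x assume "x \<in> carrier ?R"
    then show "\<exists>y\<in>carrier ?R. y \<oplus>\<^bsub>?R\<^esub> x = \<zero>\<^bsub>?R\<^esub>"
      by (intro bexI[of _ "\<lambda>w. - x w"]) (auto simp: free_algebra_def)
  qed (auto simp: free_algebra_def algebra_simps)
  show "monoid ?R"
  proof (rule monoidI)
    fix x y assume xy: "x \<in> carrier ?R" "y \<in> carrier ?R"
    let ?S = "(\<lambda>(u, v). u @ v) ` ({w. x w \<noteq> 0} \<times> {w. y w \<noteq> 0})"
    have sub: "{w. (x \<otimes>\<^bsub>?R\<^esub> y) w \<noteq> 0} \<subseteq> ?S"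
    proof
      fix w assume "w \<in> {w. (x \<otimes>\<^bsub>?R\<^esub> y) w \<noteq> 0}"
      then obtain k where k: "x (take k w) * y (drop k w) \<noteq> 0"
        by (auto simp: free_algebra_def elim: sum.not_neutral_contains_not_neutral)
      then show "w \<in> ?S"
        by (intro image_eqI[of _ _ "(take k w, drop k w)"]) auto
    qed
    have "finite ?S" using xy by (auto simp: free_algebra_def)
    then have "finite {w. (x \<otimes>\<^bsub>?R\<^esub> y) w \<noteq> 0}" using sub by (rule rev_finite_subset)
    moreover have "?S \<subseteq> lists G" using xy by (fastforce simp: free_algebra_def)
    then have "{w. (x \<otimes>\<^bsub>?R\<^esub> y) w \<noteq> 0} \<subseteq> lists G" using sub by blast
    ultimately show "x \<otimes>\<^bsub>?R\<^esub> y \<in> carrier ?R" by (simp add: free_algebra_def)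
  next
    fix x assume "x \<in> carrier ?R"
    show "\<one>\<^bsub>?R\<^esub> \<otimes>\<^bsub>?R\<^esub> x = x"
    proof
      fix w
      have "(\<Sum>k\<le>length w. (if take k w = [] then 1 else 0) * x (drop k w))
          = (\<Sum>k\<le>length w. if k = 0 then x w else 0)"
        by (intro sum.cong) auto
      then show "(\<one>\<^bsub>?R\<^esub> \<otimes>\<^bsub>?R\<^esub> x) w = x w" by (simp add: free_algebra_def)
    qed
    show "x \<otimes>\<^bsub>?R\<^esub> \<one>\<^bsub>?R\<^esub> = x"
    proof
      fix w
      have "(\<Sum>k\<le>length w. x (take k w) * (if drop k w = [] then 1 else 0))
          = (\<Sum>k\<le>length w. if k = length w then x w else 0)"
        by (intro sum.cong) auto
      then show "(x \<otimes>\<^bsub>?R\<^esub> \<one>\<^bsub>?R\<^esub>) w = x w" by (simp add: free_algebra_def)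
    qed
  next
    fix x y z
    show "x \<otimes>\<^bsub>?R\<^esub> y \<otimes>\<^bsub>?R\<^esub> z = x \<otimes>\<^bsub>?R\<^esub> (y \<otimes>\<^bsub>?R\<^esub> z)"
      unfolding free_algebra_def monoid.simps by (rule ext) (rule conv_assoc)
  qed (auto simp: free_algebra_def)
qed (auto simp: free_algebra_def algebra_simps sum.distrib)


section \<open>The noncommutative polygon algebra\<close>

definition cyclic :: "nat \<Rightarrow> nat list \<Rightarrow> bool" where
  "cyclic n xs \<longleftrightarrow> set xs \<subseteq> {1..n} \<and> distinct xs \<and> (\<exists>k. sorted_wrt (<) (rotate k xs))"

definition chords :: "nat \<Rightarrow> (nat \<times> nat) set" where
  "chords n = {(i, j). i \<in> {1..n} \<and> j \<in> {1..n} \<and> i \<noteq> j}"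

datatype symbol = X nat nat | Xinv nat nat

definition symbols :: "nat \<Rightarrow> symbol set" where
  "symbols n = (\<Union>(i, j)\<in>chords n. {X i j, Xinv i j})"

abbreviation FA :: "nat \<Rightarrow> (symbol list \<Rightarrow> rat) ring" where
  "FA n \<equiv> free_algebra (symbols n)"

definition inverse_relators :: "nat \<Rightarrow> (symbol list \<Rightarrow> rat) set" where
  "inverse_relators n =
    (\<Union>(i, j)\<in>chords n.
      {monomial [X i j, Xinv i j] \<ominus>\<^bsub>FA n\<^esub> \<one>\<^bsub>FA n\<^esub>,
       monomial [Xinv i j, X i j] \<ominus>\<^bsub>FA n\<^esub> \<one>\<^bsub>FA n\<^esub>})"

definition triangle_relators :: "nat \<Rightarrow> (symbol list \<Rightarrow> rat) set" where
  "triangle_relators n =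
    {monomial [X i j, Xinv k j, X k i] \<ominus>\<^bsub>FA n\<^esub> monomial [X i k, Xinv j k, X j i] | i j k.
      {i, j, k} \<subseteq> {1..n} \<and> distinct [i, j, k]}"

definition exchange_relators :: "nat \<Rightarrow> (symbol list \<Rightarrow> rat) set" where
  "exchange_relators n =
    {monomial [X j l] \<ominus>\<^bsub>FA n\<^esub>
       (monomial [X j k, Xinv i k, X i l] \<oplus>\<^bsub>FA n\<^esub> monomial [X j i, Xinv k i, X k l]) | i j k l.
      cyclic n [i, j, k, l]}"

text \<open>The ideal is two-sided; since \<open>\<rat>\<close> embeds in the centre of the free algebra, it is also
  a \<open>\<rat>\<close>-subspace, so the quotient ring is the \<open>\<rat>\<close>-algebra with the given presentation.\<close>

definition relation_ideal :: "nat \<Rightarrow> (symbol list \<Rightarrow> rat) set" where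
  "relation_ideal n =
    Idl\<^bsub>FA n\<^esub> (inverse_relators n \<union> triangle_relators n \<union> exchange_relators n)"

definition polygon_algebra :: "nat \<Rightarrow> (symbol list \<Rightarrow> rat) set ring" where
  "polygon_algebra n = FA n Quot relation_ideal n"

definition x_chord :: "nat \<Rightarrow> nat \<Rightarrow> nat \<Rightarrow> (symbol list \<Rightarrow> rat) set" where
  "x_chord n i j = relation_ideal n +>\<^bsub>FA n\<^esub> monomial [X i j]"

definition x_chord_inv :: "nat \<Rightarrow> nat \<Rightarrow> nat \<Rightarrow> (symbol list \<Rightarrow> rat) set" where
  "x_chord_inv n i j = relation_ideal n +>\<^bsub>FA n\<^esub> monomial [Xinv i j]"

text \<open>Only sequences of even positive length are meaningful; the first two equations are
  never used for those.\<close>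

fun x_seq :: "nat \<Rightarrow> nat list \<Rightarrow> (symbol list \<Rightarrow> rat) set" where
  "x_seq n [] = \<one>\<^bsub>polygon_algebra n\<^esub>"
| "x_seq n [a] = \<one>\<^bsub>polygon_algebra n\<^esub>"
| "x_seq n [a, b] = x_chord n a b"
| "x_seq n (a # b # c # s) =
     x_chord n a b \<otimes>\<^bsub>polygon_algebra n\<^esub> x_chord_inv n c b \<otimes>\<^bsub>polygon_algebra n\<^esub> x_seq n (c # s)"


section \<open>Triangulations\<close>

definition crosses :: "nat \<Rightarrow> nat \<times> nat \<Rightarrow> nat \<times> nat \<Rightarrow> bool" where
  "crosses n c d \<longleftrightarrow> cyclic n [fst c, fst d, snd c, snd d]"

definition crossing_free :: "nat \<Rightarrow> (nat \<times> nat) set \<Rightarrow> bool" where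
  "crossing_free n D \<longleftrightarrow> D \<subseteq> chords n \<and> (\<forall>c\<in>D. \<forall>d\<in>D. \<not> crosses n c d)"

definition triangulation :: "nat \<Rightarrow> (nat \<times> nat) set \<Rightarrow> bool" where
  "triangulation n \<Delta> \<longleftrightarrow>
     crossing_free n \<Delta> \<and> (\<forall>D. crossing_free n D \<and> \<Delta> \<subseteq> D \<longrightarrow> D = \<Delta>)"


section \<open>Admissible sequences\<close>

text \<open>The plane is \<open>\<complex>\<close>. The points \<open>P 1, \<dots>, P n\<close> are the vertices of a (strictly) convex
  \<open>n\<close>-gon, listed counterclockwise: every cyclic triple is positively oriented.\<close>

definition convex_ngon :: "nat \<Rightarrow> (nat \<Rightarrow> complex) \<Rightarrow> bool" where
  "convex_ngon n P \<longleftrightarrow>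
     (\<forall>i j k. cyclic n [i, j, k] \<longrightarrow> Im (cnj (P j - P i) * (P k - P i)) > 0)"

lemma convex_ngon_parabola: "convex_ngon n (\<lambda>k. Complex (real k) (real k ^ 2))"
  unfolding convex_ngon_def
proof (intro allI impI)
  fix i j k assume "cyclic n [i, j, k]"
  then obtain r where r: "sorted_wrt (<) (rotate r [i, j, k])" by (auto simp: cyclic_def)
  have rot: "rotate r [i, j, k] = rotate (r mod 3) [i, j, k]"
    using rotate_conv_mod[of r "[i, j, k]"] by (simp only: list.size) simp
  have "r mod 3 = 0 \<or> r mod 3 = Suc 0 \<or> r mod 3 = Suc (Suc 0)" by linarith
  then have "i < j \<and> j < k \<or> j < k \<and> k < i \<or> k < i \<and> i < j"
    using r unfolding rot by (elim disjE) (simp_all only: rotate_Suc, simp_all)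
  then have "real i < real j \<and> real j < real k \<or> real j < real k \<and> real k < real i
      \<or> real k < real i \<and> real i < real j"
    by simp
  then have "(real j - real i) * (real k - real i) * (real k - real j) > 0"
    by (elim disjE) (simp_all add: mult_neg_neg mult_pos_neg mult_neg_pos)
  also have "(real j - real i) * (real k - real i) * (real k - real j) =
      Im (cnj (Complex (real j) (real j ^ 2) - Complex (real i) (real i ^ 2)) *
      (Complex (real k) (real k ^ 2) - Complex (real i) (real i ^ 2)))"
    by (simp add: power2_eq_square) (simp add: algebra_simps)
  finally show "Im (cnj (Complex (real j) (real j ^ 2) - Complex (real i) (real i ^ 2)) *
      (Complex (real k) (real k ^ 2) - Complex (real i) (real i ^ 2))) > 0" .
qed

definition chord :: "(nat \<Rightarrow> complex) \<Rightarrow> nat \<Rightarrow> nat \<Rightarrow> complex set" where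
  "chord P a b = closed_segment (P a) (P b)"

text \<open>A sequence \<open>(i\<^sub>1, \<dots>, i\<^sub>2\<^sub>m)\<close> is the list \<open>w\<close> with \<open>w ! (s - 1) = i\<^sub>s\<close>. Chords are closed segments, so
  chords that share an endpoint also intersect; a chord that overlaps \<open>(i, j)\<close> in a segment
  contributes all of its points to the ordering condition. Excluding shared endpoints instead
  would give the same set, since the ordering condition is strict.\<close>

definition Adm :: "nat \<Rightarrow> (nat \<Rightarrow> complex) \<Rightarrow> (nat \<times> nat) set \<Rightarrow> nat \<Rightarrow> nat \<Rightarrow> nat list set" where
  "Adm n P \<Delta> i j = {w. \<exists>m\<ge>1. length w = 2 * m \<and> set w \<subseteq> {1..n} \<and>
     w ! 0 = i \<and> w ! (2 * m - 1) = j \<and>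
     (\<forall>s\<in>{1..2 * m - 1}. (w ! (s - 1), w ! s) \<in> \<Delta>) \<and>
     (\<forall>s\<in>{1..m - 1}. chord P (w ! (2 * s - 1)) (w ! (2 * s)) \<inter> chord P i j \<noteq> {}) \<and>
     (\<forall>k\<in>{1..2 * m - 1}. \<forall>l\<in>{1..2 * m - 1}. k < l \<longrightarrow>
        (\<forall>p \<in> chord P (w ! (k - 1)) (w ! k) \<inter> chord P i j.
         \<forall>q \<in> chord P (w ! (l - 1)) (w ! l) \<inter> chord P i j. dist (P i) p < dist (P i) q))}"

end

(* Order the vertices cyclically, starting at j. A chord avoiding j then becomes an interval; it
   crosses (i, j) iff this interval contains i in its interior, and the chords of the triangulation
   that cross (i, j) form a chain of nested intervals, ordered along (i, j) from i to j by inclusion.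

   Induct on the number of chords of the triangulation that cross (i, j). If there is none, (i, j) is
   itself a chord and the only admissible sequence. Otherwise let (a, b) be the crossing chord nearest
   to i; then (i, a) and (i, b) belong to the triangulation, and the exchange relation reads
     x_ij = x_ia x_ba^-1 x_bj + x_ib x_ab^-1 x_aj.
   Fewer chords cross (b, j) and (a, j). Prefixing (i, a) to an admissible sequence from b to j, and
   cancelling x_ba^-1 x_ba when that sequence begins with (b, a), gives exactly the admissible
   sequences from i to j that begin with (i, a); likewise for those that begin with (i, b). *)
theory Submission
  imports Defs
begin

section \<open>Admissible sequences in a triangulation rooted at a vertex\<close>

text \<open>The end \<open>j\<close> stays the root while the start moves from \<open>i\<close> to
  \<open>a\<close> or \<open>b\<close>, so one ranking serves the whole induction. What does change
  is the diagonal against which admissibility is tested. Among chords of the triangulation, those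
  crossing \<open>(b, j)\<close> are exactly those crossing \<open>(i, j)\<close> that do not end at
  \<open>b\<close>. An admissible sequence from \<open>b\<close> never returns to \<open>b\<close>,
  so only its first chord \<open>(b, x)\<close> can change status, and prefixing
  \<open>(i, a), (a, b)\<close> adds only the inequalities that put \<open>(a, b)\<close> before
  \<open>(b, x)\<close> and these two before the later crossing chords. The second obstacle is
  geometric: closed segments also meet in shared ends, and steps in odd positions may or may not
  cross. The strict ordering against the first and last steps keeps all other steps away from both
  ends of the diagonal. Then meeting is proper crossing, and positions of crossing points can be
  compared by lengths of rank intervals.\<close>

abbreviation edges :: "'v list \<Rightarrow> ('v \<times> 'v) list" where
  "edges w \<equiv> zip w (tl w)"

text \<open>\<open>Q\<close> is tested on the second, fourth, ... step, those that contribute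
  inverses. The last equation rejects odd and empty lengths, so the predicate also carries the
  parity.\<close>

fun alternating :: "('v \<times> 'v \<Rightarrow> bool) \<Rightarrow> 'v list \<Rightarrow> bool" where
  "alternating Q [a, b] \<longleftrightarrow> True"
| "alternating Q (a # b # c # s) \<longleftrightarrow> Q (b, c) \<and> alternating Q (c # s)"
| "alternating Q _ \<longleftrightarrow> False"

lemma alternating_iff_nth:
  "alternating Q w \<longleftrightarrow>
     (\<exists>m\<ge>1. length w = 2 * m \<and> (\<forall>s\<in>{1..m - 1}. Q (w ! (2 * s - 1), w ! (2 * s))))"
proof (induction Q w rule: alternating.induct)
  case (1 Q a b)
  show ?case by (auto intro!: exI[of _ 1])
next
  case (2 Q a b c s)
  let ?P = "\<lambda>m w. m \<ge> 1 \<and> length w = 2 * m \<and> (\<forall>s\<in>{1..m - 1}. Q (w ! (2 * s - 1), w ! (2 * s)))"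
  let ?w = "a # b # c # s"
  have split: "?P (Suc m) ?w \<longleftrightarrow> Q (b, c) \<and> ?P m (c # s)" if "m \<ge> 1" for m
  proof -
    have "(\<forall>k\<in>{1..m}. R k) \<longleftrightarrow> R 1 \<and> (\<forall>k\<in>{1..m - 1}. R (Suc k))" for R
    proof
      assume *: "R 1 \<and> (\<forall>k\<in>{1..m - 1}. R (Suc k))"
      show "\<forall>k\<in>{1..m}. R k"
      proof
        fix k assume "k \<in> {1..m}"
        with * show "R k" by (cases "k = 1") (auto dest!: bspec[of _ _ "k - 1"])
      qed
    qed (use that in auto)
    from this[of "\<lambda>s. Q (?w ! (2 * s - 1), ?w ! (2 * s))"] show ?thesis
      using that by (auto simp: nth_Cons' split: if_splits)
  qed
  have "(\<exists>m. ?P m ?w) \<longleftrightarrow> (\<exists>m\<ge>1. ?P (Suc m) ?w)"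
  proof
    assume "\<exists>m. ?P m ?w"
    then obtain m where m: "?P m ?w" by blast
    then have "m \<ge> 2" by auto
    with m show "\<exists>m\<ge>1. ?P (Suc m) ?w" by (intro exI[of _ "m - 1"]) auto
  qed auto
  also have "\<dots> \<longleftrightarrow> Q (b, c) \<and> (\<exists>m. ?P m (c # s))" using split by blast
  finally show ?case using 2 by simp
qed auto

lemma edges_Cons_subset: "set (edges t) \<subseteq> set (edges (c # t))"
  by (cases t) auto

text \<open>The tested steps involve neither the first nor the last vertex, so \<open>Q\<close> and
  \<open>Q'\<close> need comparing on inner edges only.\<close>

lemma alternating_mono:
  "alternating Q w \<Longrightarrow> (\<And>e. e \<in> set (edges (butlast (tl w))) \<Longrightarrow> Q e \<Longrightarrow> Q' e) \<Longrightarrow>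
    alternating Q' w"
proof (induction Q w rule: alternating.induct)
  case (2 Q a b c s)
  from 2(2) have "butlast (tl (a # b # c # s)) = b # c # butlast s" by (cases s) auto
  with 2 show ?case using edges_Cons_subset[of "butlast s" c] by auto
qed auto

lemma alternating_cases:
  assumes "alternating Q w"
  obtains a b where "w = [a, b]"
    | a b c s where "w = a # b # c # s" "Q (b, c)" "alternating Q (c # s)"
  using assms by (cases "(Q, w)" rule: alternating.cases) auto

lemma edges_Cons_snoc: "t \<noteq> [] \<Longrightarrow> edges (a # t @ [b]) = (a, hd t) # edges t @ [(last t, b)]"
proof (induction t arbitrary: a)
  case (Cons c t)
  then show ?case by (cases t) auto
qed simp

lemma edges_inner_subset: "set (edges (butlast (tl w))) \<subseteq> set (edges w)"
proof (cases w)
  case (Cons a t)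
  then show ?thesis
  proof (cases t rule: rev_cases)
    case (snoc u b)
    then show ?thesis using Cons by (cases "u = []") (auto simp: edges_Cons_snoc[simplified])
  qed simp
qed simp

lemma edges_subset: "set (edges w) \<subseteq> set w \<times> set w"
proof (intro subrelI SigmaI)
  fix a b assume e: "(a, b) \<in> set (edges w)"
  have "set (tl w) \<subseteq> set w" by (cases w) auto
  with e show "a \<in> set w" "b \<in> set w" by (auto dest: set_zip_leftD set_zip_rightD)
qed

text \<open>The tested steps pair off all vertices except the first and the last. This is what keeps
  inner vertices of an admissible sequence away from its start and from the root.\<close>

lemma alternating_inner_vertex:
  "alternating Q w \<Longrightarrow> v \<in> set (butlast (tl w)) \<Longrightarrow>
    \<exists>u. Q (u, v) \<or> Q (v, u)"
  by (induction Q w rule: alternating.induct) (auto split: if_splits)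

text \<open>The rank \<open>f\<close> numbers the vertices in cyclic order, starting with \<open>0\<close> at the root \<open>r\<close>.\<close>

locale rooted_triangulation =
  fixes V :: "'v set" and f :: "'v \<Rightarrow> nat" and r :: 'v and D :: "('v \<times> 'v) set"
  assumes inj_rank: "inj_on f V"
    and root: "r \<in> V" "f r = 0"
    and D_subset: "D \<subseteq> V \<times> V"
    and irrefl: "(a, b) \<in> D \<Longrightarrow> a \<noteq> b"
    and sym: "(a, b) \<in> D \<Longrightarrow> (b, a) \<in> D"
    and noncrossing: "(a, b) \<in> D \<Longrightarrow> (c, d) \<in> D \<Longrightarrow> f a < f c \<Longrightarrow> f c < f b \<Longrightarrow> f b < f d \<Longrightarrow> False"
    and maximal: "a \<in> V \<Longrightarrow> b \<in> V \<Longrightarrow> f a < f b \<Longrightarrow>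
      (\<And>c d. (c, d) \<in> D \<Longrightarrow> f a < f c \<Longrightarrow> f c < f b \<Longrightarrow> f d < f a \<or> f b < f d \<Longrightarrow> False) \<Longrightarrow>
      (a, b) \<in> D"
begin

text \<open>Proper crossing with the chord \<open>(i, r)\<close>. The root has rank 0, so positivity
  excludes chords that end there.\<close>

definition separates :: "'v \<Rightarrow> 'v \<times> 'v \<Rightarrow> bool" where
  "separates i = (\<lambda>(u, v). 0 < f u \<and> 0 < f v \<and>
     (f u < f i \<and> f i < f v \<or> f v < f i \<and> f i < f u))"

definition width :: "'v \<times> 'v \<Rightarrow> int" where
  "width = (\<lambda>(u, v). \<bar>int (f u) - int (f v)\<bar>)"

text \<open>Noncrossing chords that separate \<open>i\<close> from the root are nested, so along the chord \<open>(i, r)\<close> their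
  crossing points are ordered by width.\<close>

definition adm :: "'v \<Rightarrow> 'v list set" where
  "adm i = {w. hd w = i \<and> last w = r \<and> set (edges w) \<subseteq> D \<and> alternating (separates i) w \<and>
     sorted_wrt (\<lambda>c d. separates i c \<longrightarrow> separates i d \<longrightarrow> width c < width d) (edges w)}"

lemma width_nonneg: "0 \<le> width c"
  by (simp add: width_def split: prod.splits)

lemma rank_eq: "a \<in> V \<Longrightarrow> b \<in> V \<Longrightarrow> f a = f b \<longleftrightarrow> a = b"
  using inj_rank by (auto dest: inj_onD)

lemma D_V: "(a, b) \<in> D \<Longrightarrow> a \<in> V \<and> b \<in> V \<and> a \<noteq> b \<and> f a \<noteq> f b \<and> (b, a) \<in> D"
  using D_subset irrefl sym rank_eq by blast

lemma noncrossing_all: "(a, b) \<in> D \<Longrightarrow> (c, d) \<in> D \<Longrightarrow>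
    \<not> (f a < f c \<and> f c < f b \<and> f b < f d) \<and> \<not> (f c < f a \<and> f a < f d \<and> f d < f b)
  \<and> \<not> (f a < f d \<and> f d < f b \<and> f b < f c) \<and> \<not> (f c < f b \<and> f b < f d \<and> f d < f a)
  \<and> \<not> (f b < f c \<and> f c < f a \<and> f a < f d) \<and> \<not> (f d < f a \<and> f a < f c \<and> f c < f b)
  \<and> \<not> (f b < f d \<and> f d < f a \<and> f a < f c) \<and> \<not> (f d < f b \<and> f b < f c \<and> f c < f a)"
  by (intro conjI) (use noncrossing sym in blast)+

lemma separates_cases:
  assumes "separates i c"
  obtains u v where "c = (u, v) \<or> c = (v, u)" "0 < f u" "f u < f i" "f i < f v"
  using assms by (cases c) (auto simp: separates_def)

lemma width_cases:
  assumes "separates i c" "c \<in> D"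
  obtains u v where "c = (u, v) \<or> c = (v, u)" "0 < f u" "f u < f i" "f i < f v" "(u, v) \<in> D"
    "width c = int (f v) - int (f u)" "{fst c, snd c} = {u, v}"
proof -
  obtain u v where c: "c = (u, v) \<or> c = (v, u)" "0 < f u" "f u < f i" "f i < f v"
    by (rule separates_cases[OF assms(1)])
  show thesis by (rule that[of u v]) (use c assms(2) sym in \<open>auto simp: width_def\<close>)
qed

lemma separates_empty:
  assumes "(i, r) \<in> D" "c \<in> D" "separates i c"
  shows False
proof -
  obtain u v where "0 < f u" "f u < f i" "f i < f v" "(u, v) \<in> D"
    using width_cases[OF assms(3,2)] by metis
  then show False using noncrossing[OF sym[OF assms(1)]] root by simp
qed

text \<open>A longer sequence would contain a tested step, that is, a chord of \<open>D\<close>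
  crossing \<open>(i, r)\<close>.\<close>

lemma adm_base:
  assumes "(i, r) \<in> D"
  shows "adm i = {[i, r]}"
proof -
  have "w = [i, r]" if "w \<in> adm i" for w
  proof -
    from that have "alternating (separates i) w" by (simp add: adm_def)
    then show ?thesis
    proof (cases rule: alternating_cases)
      case (2 a b c s)
      then have "(b, c) \<in> D" using that by (auto simp: adm_def)
      with 2 separates_empty[OF assms] show ?thesis by blast
    qed (use that in \<open>auto simp: adm_def\<close>)
  qed
  moreover have "[i, r] \<in> adm i" using assms by (auto simp: adm_def)
  ultimately show ?thesis by blast
qed

text \<open>Both rank intervals contain \<open>i\<close> in their interior, so they overlap; as the
  chords do not cross, one contains the other, and the width tells which.\<close>

lemma separates_width_nested:
  assumes "c \<in> D" "d \<in> D" "separates i c" "separates i d" "width c < width d"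
  obtains u v x y where "{fst c, snd c} = {u, v}" "{fst d, snd d} = {x, y}"
    "0 < f x" "f x \<le> f u" "f u < f i" "f i < f v" "f v \<le> f y" "f x < f u \<or> f v < f y"
proof -
  obtain u v where c: "c = (u, v) \<or> c = (v, u)" "f u < f i" "f i < f v" "0 < f u"
    using assms(3) by (cases c) (auto simp: separates_def)
  obtain x y where d: "d = (x, y) \<or> d = (y, x)" "f x < f i" "f i < f y" "0 < f x"
    using assms(4) by (cases d) (auto simp: separates_def)
  have "(u, v) \<in> D" "(x, y) \<in> D" using c(1) d(1) assms(1,2) sym by auto
  then have "f x \<le> f u" "f v \<le> f y" "f x < f u \<or> f v < f y"
    using noncrossing_all[of u v x y] c d assms(5) by (auto simp: width_def)
  with c d show thesis by (intro that[of u v x y]) auto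
qed

lemma separates_width_eq:
  assumes "c \<in> D" "d \<in> D" "separates i c" "separates i d" "width c = width d"
  shows "{fst c, snd c} = {fst d, snd d}"
proof -
  obtain u v where c: "c = (u, v) \<or> c = (v, u)" "f u < f i" "f i < f v" "0 < f u"
    using assms(3) by (cases c) (auto simp: separates_def)
  obtain x y where d: "d = (x, y) \<or> d = (y, x)" "f x < f i" "f i < f y" "0 < f x"
    using assms(4) by (cases d) (auto simp: separates_def)
  have uv: "(u, v) \<in> D" "(x, y) \<in> D" using c(1) d(1) assms(1,2) sym by auto
  then have "f x = f u" "f v = f y"
    using noncrossing_all[of u v x y] c d assms(5) by (auto simp: width_def)
  then have "x = u" "v = y" using uv D_subset rank_eq by auto
  with c(1) d(1) show ?thesis by auto
qed

text \<open>The chord \<open>(a, b)\<close> is a separating chord of least width; any chord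
  obstructing \<open>(i, a)\<close> or \<open>(i, b)\<close> would separate with smaller
  width.\<close>

lemma obtain_triangle:
  assumes "i \<in> V" "i \<noteq> r" "(i, r) \<notin> D"
  obtains a b where "(a, b) \<in> D" "(i, a) \<in> D" "(i, b) \<in> D" "separates i (a, b)" "f a < f b"
    "\<And>c. c \<in> D \<Longrightarrow> separates i c \<Longrightarrow> width (a, b) \<le> width c"
proof -
  have fi: "0 < f i" using assms rank_eq[of i r] root by simp
  have "(r, i) \<notin> D" using assms sym by blast
  then obtain c d where "(c, d) \<in> D" "0 < f c" "f c < f i" "f i < f d"
    using maximal[of r i] assms(1) fi root by auto
  then have "(c, d) \<in> D \<and> separates i (c, d)" by (simp add: separates_def)
  then obtain e where e: "e \<in> D" "separates i e"
    and least: "\<And>c. c \<in> D \<Longrightarrow> separates i c \<Longrightarrow> nat (width e) \<le> nat (width c)"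
    using ex_has_least_nat[of "\<lambda>e. e \<in> D \<and> separates i e" "(c, d)" "\<lambda>e. nat (width e)"] by metis
  have min_e: "width e \<le> width c" if "c \<in> D" "separates i c" for c
    using least[OF that] width_nonneg[of c] by simp
  obtain a b where e_eq: "e = (a, b) \<or> e = (b, a)" and ab: "f a < f i" "f i < f b" "0 < f a"
    using e(2) by (cases e) (auto simp: separates_def)
  have abD: "(a, b) \<in> D" using e_eq e(1) sym by auto
  have w: "width e = int (f b) - int (f a)" using e_eq ab by (auto simp: width_def)
  have "(a, i) \<in> D"
  proof (rule maximal)
    \<comment> \<open>An obstructing chord starts strictly between \<open>a\<close> and
      \<open>i\<close>. Since it does not cross \<open>(a, b)\<close>, it ends beyond
      \<open>i\<close> but not beyond \<open>b\<close>.\<close>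
    fix c d assume cd: "(c, d) \<in> D" "f a < f c" "f c < f i" "f d < f a \<or> f i < f d"
    then have "f i < f d" "f d \<le> f b" using noncrossing_all[OF abD cd(1)] ab by auto
    with cd show False using min_e[OF cd(1)] w ab by (auto simp: separates_def width_def)
  qed (use assms abD D_V ab in auto)
  moreover have "(i, b) \<in> D"
  proof (rule maximal)
    fix c d assume cd: "(c, d) \<in> D" "f i < f c" "f c < f b" "f d < f i \<or> f b < f d"
    then have "f d < f i" "f a \<le> f d" using noncrossing_all[OF abD cd(1)] ab by auto
    with cd show False using min_e[OF cd(1)] w ab by (auto simp: separates_def width_def)
  qed (use assms abD D_V ab in auto)
  ultimately show thesis
    using abD ab sym min_e w
    by (intro that[of a b]) (auto simp: separates_def width_def)
qed

end

section \<open>Transfer of admissible sequences across the first triangle\<close>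

definition reroute :: "'v \<Rightarrow> 'v \<Rightarrow> 'v list \<Rightarrow> 'v list" where
  "reroute i a w = (if w ! 1 = a then i # tl w else i # a # w)"

text \<open>\<open>D\<close> contains the triangle \<open>i a b\<close>, whose side \<open>(a, b)\<close> is the first chord of \<open>D\<close> crossed on the
  way from \<open>i\<close> to the root.\<close>

locale first_triangle = rooted_triangulation V f r D
  for V :: "'v set" and f r D +
  fixes i a b :: 'v
  assumes ab: "(a, b) \<in> D" and ia: "(i, a) \<in> D" and ib: "(i, b) \<in> D"
    and sep_ab: "separates i (a, b)"
    and minimal: "c \<in> D \<Longrightarrow> separates i c \<Longrightarrow> width (a, b) \<le> width c"
begin

text \<open>The locale does not fix which of \<open>a\<close> and \<open>b\<close> has the smaller
  rank, so every result about the first step \<open>(i, a)\<close> yields its mirror image by a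
  second interpretation.\<close>

lemma swap: "first_triangle V f r D i b a"
proof unfold_locales
  show "separates i (b, a)" using sep_ab by (auto simp: separates_def)
  have "width (b, a) = width (a, b)" by (simp add: width_def)
  then show "width (b, a) \<le> width c" if "c \<in> D" "separates i c" for c
    using minimal[OF that] by simp
qed (use ab ia ib sym in auto)

text \<open>A chord with \<open>b\<close> strictly inside its interval cannot cross
  \<open>(a, b)\<close>, so the closed interval contains \<open>a\<close> as well, and
  \<open>i\<close> lies strictly between the two.\<close>

lemma separates_far:
  assumes "c \<in> D" "separates b c"
  shows "separates i c"
proof -
  obtain u v where c: "c = (u, v) \<or> c = (v, u)" "0 < f u" "f u < f b" "f b < f v"
    using assms(2) by (rule separates_cases)
  then have "(u, v) \<in> D" using assms sym by auto
  then have "\<not> (f a < f u \<and> f u < f b \<and> f b < f v)" "\<not> (f u < f b \<and> f b < f v \<and> f v < f a)"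
    using noncrossing ab sym by blast+
  then have "f u < f i \<and> f i < f v"
    using c sep_ab unfolding separates_def split by linarith
  with c show ?thesis by (auto simp: separates_def)
qed

text \<open>By minimality the interval of \<open>c\<close> contains that of \<open>(a, b)\<close>;
  not ending at \<open>b\<close>, it has \<open>b\<close> in its interior.\<close>

lemma separates_near:
  assumes "c \<in> D" "separates i c" "b \<notin> {fst c, snd c}"
  shows "separates b c"
proof -
  obtain u v where c: "c = (u, v) \<or> c = (v, u)" "0 < f u" "f u < f i" "f i < f v"
    and uv: "(u, v) \<in> D" "width c = int (f v) - int (f u)" "{fst c, snd c} = {u, v}"
    by (rule width_cases[OF assms(2,1)])
  obtain p q where pq: "0 < f p" "f p < f i" "f i < f q" "(p, q) \<in> D"
    "width (a, b) = int (f q) - int (f p)" "{a, b} = {p, q}"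
    by (rule width_cases[OF sep_ab ab]) auto
  have "f u \<le> f p \<and> f q \<le> f v"
    using noncrossing_all[OF uv(1) pq(4)] minimal[OF assms(1,2)] c pq uv(2)
    by auto
  moreover have "f u \<noteq> f b" "f v \<noteq> f b"
    using assms(3) uv D_V[of u v] D_V[OF ab] rank_eq by auto
  moreover have "b = p \<or> b = q" using pq(6) by blast
  ultimately have "f u < f b \<and> f b < f v" using pq c by force
  with c show ?thesis by (auto simp: separates_def)
qed

text \<open>The interval of \<open>d\<close> contains that of \<open>c\<close>, which already has
  \<open>b\<close> in its interior.\<close>

lemma separates_wider:
  assumes "c \<in> D" "d \<in> D" "separates b c" "separates i d" "width c < width d"
  shows "separates b d"
proof (rule separates_near)
  show "b \<notin> {fst d, snd d}"
  proof
    assume b: "b \<in> {fst d, snd d}"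
    have "separates i c" using separates_far assms by blast
    from separates_width_nested[OF assms(1,2) this assms(4,5)]
    obtain u v x y where *: "{fst c, snd c} = {u, v}" "{fst d, snd d} = {x, y}"
      "f x \<le> f u" "f u < f i" "f i < f v" "f v \<le> f y" by metis
    from *(1) assms(3) *(4,5) have "f u < f b" "f b < f v"
      by (auto simp: separates_def doubleton_eq_iff split: prod.splits)
    with * b show False by auto
  qed
qed (use assms in auto)

text \<open>Needed for the step \<open>(b, x)\<close>, which may separate \<open>i\<close> but never
  \<open>b\<close>. Were \<open>c\<close> wider than \<open>d\<close>, it would separate its own
  endpoint \<open>b\<close>; equal widths would make \<open>b\<close> an endpoint of
  \<open>d\<close>.\<close>

lemma width_wider:
  assumes "c \<in> D" "d \<in> D" "separates i c" "b \<in> {fst c, snd c}" "separates b d"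
  shows "width c < width d"
proof (rule ccontr)
  assume "\<not> ?thesis"
  then consider "width d < width c" | "width d = width c" by linarith
  then show False
  proof cases
    case 1
    then have "separates b c" using separates_wider[OF assms(2,1,5,3)] by simp
    then show False using assms(4) by (auto simp: separates_def)
  next
    case 2
    then have "b \<in> {fst d, snd d}"
      using separates_width_eq[OF assms(2,1)] separates_far assms by blast
    then show False using assms(5) by (auto simp: separates_def)
  qed
qed

lemma minimal_strict:
  assumes "c \<in> D" "separates i c" "{fst c, snd c} \<noteq> {a, b}"
  shows "width (a, b) < width c"
  using minimal[OF assms(1,2)] separates_width_eq[OF ab assms(1) sep_ab assms(2)] assms(3) by force

lemma far_vertex_notin_tail:
  assumes "w \<in> adm b"
  shows "b \<notin> set (tl w)"
proof
  assume b: "b \<in> set (tl w)"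
  have "b \<noteq> last w" using assms sep_ab root by (auto simp: adm_def separates_def)
  moreover from b have "tl w = butlast (tl w) @ [last w]"
    by (metis append_butlast_last_id empty_iff empty_set last_tl)
  then have "b \<in> set (butlast (tl w) @ [last w])" using b by simp
  ultimately have "b \<in> set (butlast (tl w))" by simp
  moreover have "alternating (separates b) w" using assms by (simp add: adm_def)
  ultimately obtain u where "separates b (u, b) \<or> separates b (b, u)"
    using alternating_inner_vertex by metis
  then show False by (auto simp: separates_def)
qed

lemma sep_iff_of_avoiding:
  assumes "set (edges w) \<subseteq> D" "b \<notin> set w" "e \<in> set (edges w)"
  shows "separates i e \<longleftrightarrow> separates b e"
proof -
  have "fst e \<in> set w" "snd e \<in> set (tl w)"
    using assms(3) set_zip_leftD[of "fst e" "snd e" w "tl w"]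
      set_zip_rightD[of "fst e" "snd e" w "tl w"] by simp_all
  moreover have "set (tl w) \<subseteq> set w" by (cases w) auto
  ultimately have "b \<notin> {fst e, snd e}" using assms(2) by blast
  then show ?thesis using separates_near separates_far assms by blast
qed

lemma rank_pos: "0 < f a" "0 < f b"
  using sep_ab by (auto simp: separates_def)

lemma vertices_distinct: "a \<noteq> b" "a \<noteq> r" "b \<noteq> r" "i \<noteq> a" "i \<noteq> b"
  using rank_pos root irrefl ab ia ib by auto

lemma not_separates_endpoint:
  "\<not> separates c (c, d)" "\<not> separates c (d, c)" "\<not> separates c (r, d)" "\<not> separates c (d, r)"
  using root by (auto simp: separates_def)

lemma width_swap: "width (c, d) = width (d, c)"
  by (simp add: width_def)

text \<open>Replacing the start is harmless for alternation, since no tested step uses it. The work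
  lies in the order: the crossing status of \<open>(b, x)\<close> may differ for \<open>i\<close>
  and \<open>b\<close>, and \<open>(a, b)\<close> may be new.\<close>

lemma reroute_adm:
  assumes "w \<in> adm b"
  shows "reroute i a w \<in> adm i"
proof -
  have w: "hd w = b" "last w = r" "set (edges w) \<subseteq> D" "alternating (separates b) w"
    and ord: "sorted_wrt (\<lambda>c d. separates b c \<longrightarrow> separates b d \<longrightarrow> width c < width d) (edges w)"
    using assms by (auto simp: adm_def)
  from w(4) show ?thesis
  proof (cases rule: alternating_cases)
    case (1 b' r')
    then show ?thesis using w ab ia sep_ab vertices_distinct
      by (auto simp: adm_def reroute_def not_separates_endpoint)
  next
    case (2 b' x c s)
    then have w_eq: "w = b # x # c # s" using w by simp
    let ?t = "x # c # s"
    have b_t: "b \<notin> set ?t" using far_vertex_notin_tail[OF assms] w_eq by simp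
    have D_t: "set (edges ?t) \<subseteq> D" and bx: "(b, x) \<in> D" and last_t: "last ?t = r"
      using w w_eq by auto
    have iff: "separates i e \<longleftrightarrow> separates b e" if "e \<in> set (edges ?t)" for e
      using sep_iff_of_avoiding[OF D_t b_t that] .
    have ord_t: "sorted_wrt (\<lambda>c d. separates i c \<longrightarrow> separates i d \<longrightarrow> width c < width d) (edges ?t)"
    proof (rule sorted_wrt_mono_rel)
      show "sorted_wrt (\<lambda>c d. separates b c \<longrightarrow> separates b d \<longrightarrow> width c < width d) (edges ?t)"
        using ord w_eq by simp
    qed (use iff in blast)
    have alt: "alternating (separates i) (b # ?t)"
      unfolding w_eq[symmetric]
      by (rule alternating_mono[OF w(4)]) (use separates_far w(3) edges_inner_subset[of w] in blast)
    show ?thesis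
    proof (cases "x = a")
      case True
      then show ?thesis
        using w_eq alt ord_t D_t ia last_t
        by (auto simp: adm_def reroute_def not_separates_endpoint)
    next
      case False
      have "width (b, x) < width e" if "e \<in> set (edges ?t)" "separates i (b, x)" "separates i e" for e
      proof -
        have "e \<in> D" "separates b e" using that iff D_t by blast+
        then show ?thesis using width_wider[OF bx _ that(2)] by simp
      qed
      moreover have "width (a, b) < width e" if "e \<in> set (edges ?t)" "separates i e" for e
      proof (rule minimal_strict)
        show "{fst e, snd e} \<noteq> {a, b}" using that iff not_separates_endpoint
          by (metis doubleton_eq_iff prod.collapse)
      qed (use that D_t in auto)
      moreover have "width (a, b) < width (b, x)" if "separates i (b, x)"
        using that False bx by (intro minimal_strict) (auto simp: doubleton_eq_iff)
      ultimately show ?thesis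
        using w_eq alt ord_t D_t bx ab ia sep_ab False last_t
        by (auto simp: adm_def reroute_def not_separates_endpoint)
    qed
  qed
qed

text \<open>The image reveals which branch produced it: the long form contains \<open>b\<close>,
  whereas the short form keeps only the tail, from which \<open>b\<close> is absent.\<close>

lemma reroute_inj: "inj_on (reroute i a) (adm b)"
proof (rule inj_onI)
  have form: "\<exists>t. w = b # t \<and> b \<notin> set t" if "w \<in> adm b" for w
    using far_vertex_notin_tail[OF that] that by (cases w) (auto simp: adm_def)
  fix w w' assume "w \<in> adm b" "w' \<in> adm b" "reroute i a w = reroute i a w'"
  then show "w = w'"
    using form[of w] form[of w'] by (auto simp: reroute_def split: if_splits)
      (metis list.set_intros(1,2))
qed

lemma first_step:
  assumes "v \<in> adm i"
  obtains x c s where "v = i # x # c # s" "x = a \<or> x = b"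
proof -
  have v: "hd v = i" "last v = r" "set (edges v) \<subseteq> D" "alternating (separates i) v"
    using assms by (auto simp: adm_def)
  from v(4) show thesis
  proof (cases rule: alternating_cases)
    case (1 i' r')
    then have "(i, r) \<in> D" using v by auto
    then show thesis using separates_empty ab sep_ab by blast
  next
    case (2 i' x c s)
    then have v_eq: "v = i # x # c # s" and xc: "(x, c) \<in> D" and ix: "(i, x) \<in> D"
      using v by auto
    obtain u y where uy: "0 < f u" "f u < f i" "f i < f y" "(u, y) \<in> D"
      "width (x, c) = int (f y) - int (f u)" "{x, c} = {u, y}"
      by (rule width_cases[OF 2(2) xc]) auto
    obtain p q where pq: "0 < f p" "f p < f i" "f i < f q" "(p, q) \<in> D"
      "width (a, b) = int (f q) - int (f p)" "{a, b} = {p, q}"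
      by (rule width_cases[OF sep_ab ab]) auto
    have le: "f u \<le> f p \<and> f q \<le> f y"
      using noncrossing_all[OF uy(4) pq(4)] minimal[OF xc 2(2)] uy pq by auto
    \<comment> \<open>The interval of \<open>(x, c)\<close> contains that of \<open>(p, q)\<close>;
      if \<open>x\<close> lay strictly beyond \<open>p\<close> or \<open>q\<close>, the chord
      \<open>(i, x)\<close> would cross \<open>(p, q)\<close>.\<close>
    have "f x = f p \<or> f x = f q"
    proof (cases "x = u")
      case True
      then show ?thesis using noncrossing[OF sym[OF ix] pq(4)] le uy pq by fastforce
    next
      case False
      then have "x = y" using uy(6) by blast
      then show ?thesis using noncrossing[OF pq(4) ix] le uy pq by fastforce
    qed
    moreover have "x \<in> V" "p \<in> V" "q \<in> V" using D_V[OF pq(4)] D_V[OF xc] by auto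
    ultimately have "x = p \<or> x = q" using rank_eq by blast
    then have "x = a \<or> x = b" using pq(6) by blast
    with v_eq show thesis by (rule that)
  qed
qed

text \<open>The preimage is \<open>b # s\<close> if \<open>c = b\<close>, undoing the insertion of
  \<open>i, a\<close>, and \<open>b # a # c # s\<close> otherwise, undoing the cancellation.\<close>

lemma reroute_onto:
  assumes "i # a # c # s \<in> adm i"
  shows "i # a # c # s \<in> reroute i a ` adm b"
proof -
  let ?v = "i # a # c # s"
  have v: "last (c # s) = r" "(a, c) \<in> D" "set (edges (c # s)) \<subseteq> D" "separates i (a, c)"
      "alternating (separates i) (c # s)"
    and ord: "sorted_wrt (\<lambda>c d. separates i c \<longrightarrow> separates i d \<longrightarrow> width c < width d)
      ((a, c) # edges (c # s))"
    using assms by (auto simp: adm_def)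
  \<comment> \<open>Once some chord \<open>d\<close> separates \<open>b\<close>, every wider chord
    separating \<open>i\<close> separates \<open>b\<close> too.\<close>
  have alt: "alternating (separates b) t"
    if "alternating (separates i) t" "set (edges t) \<subseteq> D" "separates b d" "d \<in> D"
      "\<And>e. e \<in> set (edges t) \<Longrightarrow> separates i e \<Longrightarrow> width d < width e" for t d
    using that(1) by (rule alternating_mono) (use that(2,5) separates_wider[OF that(4) _ that(3)] edges_inner_subset[of t] in blast)
  have ord_b: "sorted_wrt (\<lambda>c d. separates b c \<longrightarrow> separates b d \<longrightarrow> width c < width d)
      ((a, c) # edges (c # s))"
    using ord by (rule sorted_wrt_mono_rel[rotated]) (use v separates_far in auto)
  show ?thesis
  proof (cases "c = b")
    case True
    have "b # s \<in> adm b \<and> s ! 0 \<noteq> a"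
      using v(5)
    proof (cases rule: alternating_cases)
      case (1 c' r')
      then show ?thesis using v True vertices_distinct by (auto simp: adm_def)
    next
      case (2 c' x y t)
      then have s: "s = x # y # t" by simp
      have D: "(b, x) \<in> D" "(x, y) \<in> D" using v(3) s True by auto
      \<comment> \<open>Otherwise \<open>(b, x)\<close> and \<open>(x, b)\<close> would be two
        crossing steps of equal width, against the strict order. The claim
        \<open>x \<noteq> a\<close> below excludes \<open>(a, b)\<close> followed by
        \<open>(b, a)\<close> in the same way.\<close>
      have "y \<noteq> b"
        using ord s 2(2) True width_swap[of x b] by (auto simp: separates_def)
      then have sep: "separates b (x, y)"
        using separates_near[OF D(2) 2(2)] irrefl[OF D(1)] by auto
      have "alternating (separates b) (y # t)"
        using 2(3) by (rule alt[OF _ _ sep D(2)]) (use v(3) ord s 2(2) in auto)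
      moreover have "x \<noteq> a"
        using ord s sep_ab True width_swap[of a b] by (auto simp: separates_def)
      ultimately show ?thesis using sep v(1,3) ord_b s True by (auto simp: adm_def)
    qed
    then show ?thesis using True by (intro image_eqI[of _ _ "b # s"]) (auto simp: reroute_def)
  next
    case False
    then have sep: "separates b (a, c)"
      using separates_near[OF v(2,4)] vertices_distinct by simp
    have "alternating (separates b) (c # s)"
      using v(5,3) by (rule alt[OF _ _ sep v(2)]) (use ord v(4) in auto)
    then have "b # a # c # s \<in> adm b"
      using sep v(1,2,3) ord_b sym[OF ab] by (auto simp: adm_def not_separates_endpoint)
    then show ?thesis by (intro image_eqI[of _ _ "b # a # c # s"]) (auto simp: reroute_def)
  qed
qed

lemma reroute_second:
  assumes "w \<in> adm b"
  shows "reroute i a w ! 1 = a"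
  using assms by (cases w) (auto simp: adm_def reroute_def)

lemma adm_step: "adm i = reroute i a ` adm b \<union> reroute i b ` adm a"
proof -
  interpret other: first_triangle V f r D i b a by (rule swap)
  have "v \<in> reroute i a ` adm b \<union> reroute i b ` adm a" if v: "v \<in> adm i" for v
  proof -
    obtain x c s where "v = i # x # c # s" "x = a \<or> x = b" by (rule first_step[OF v])
    then show ?thesis using reroute_onto other.reroute_onto v by auto
  qed
  then show ?thesis using reroute_adm other.reroute_adm by auto
qed

lemma adm_step_disjoint: "reroute i a ` adm b \<inter> reroute i b ` adm a = {}"
proof -
  interpret other: first_triangle V f r D i b a by (rule swap)
  show ?thesis using reroute_second other.reroute_second vertices_distinct(1) by force
qed

text \<open>The inclusion is strict because \<open>(a, b)\<close> separates \<open>i\<close> but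
  ends at \<open>b\<close>.\<close>

lemma crossing_decreases:
  assumes "finite D"
  shows "card {c \<in> D. separates b c} < card {c \<in> D. separates i c}"
proof (rule psubset_card_mono)
  show "{c \<in> D. separates b c} \<subset> {c \<in> D. separates i c}"
    using separates_far ab sep_ab not_separates_endpoint by blast
qed (use assms in simp)

end

section \<open>Crossing chords of a convex polygon\<close>

text \<open>Twice the signed area of the triangle \<open>a b c\<close>, positive when it runs
  counterclockwise.\<close>

definition orient :: "complex \<Rightarrow> complex \<Rightarrow> complex \<Rightarrow> real" where
  "orient a b c = Im (cnj (b - a) * (c - a))"

lemma orient_affine:
  "orient a b ((1 - t) *\<^sub>R x + t *\<^sub>R y) = (1 - t) * orient a b x + t * orient a b y"
  by (simp add: orient_def algebra_simps)

lemma orient_rotate: "orient a b c = orient b c a"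
  by (simp add: orient_def algebra_simps)

lemma orient_flip: "orient b a c = - orient a b c"
  by (simp add: orient_def algebra_simps)

lemma orient_degenerate [simp]: "orient a b a = 0" "orient a b b = 0" "orient a a b = 0"
  by (simp_all add: orient_def algebra_simps)

lemma in_segmentE:
  assumes "p \<in> closed_segment x y"
  obtains t :: real where "0 \<le> t" "t \<le> 1" "p = (1 - t) *\<^sub>R x + t *\<^sub>R y"
  using assms by (auto simp: closed_segment_def)

lemma orient_on_segment: "p \<in> closed_segment a b \<Longrightarrow> orient a b p = 0"
  by (erule in_segmentE) (simp add: orient_affine)

lemma segment_orient_pos:
  assumes "p \<in> closed_segment x y" "0 < orient a b x" "0 < orient a b y"
  shows "0 < orient a b p"
proof -
  obtain t where t: "0 \<le> t" "t \<le> 1" "p = (1 - t) *\<^sub>R x + t *\<^sub>R y"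
    using assms(1) by (rule in_segmentE)
  have "0 < (1 - t) * orient a b x + t * orient a b y"
    using t assms(2,3) by (cases "t = 0") (auto intro!: add_nonneg_pos)
  with t show ?thesis by (simp add: orient_affine)
qed

lemma segments_common_endpoint:
  assumes "orient a b c \<noteq> 0" "p \<in> closed_segment a b" "p \<in> closed_segment a c"
  shows "p = a"
proof -
  obtain t where t: "p = (1 - t) *\<^sub>R a + t *\<^sub>R c"
    using assms(3) by (rule in_segmentE)
  have "t * orient a b c = 0"
    using orient_on_segment[OF assms(2)] t by (simp add: orient_affine)
  with t assms(1) show ?thesis by simp
qed

text \<open>The weights of the crossing point come from Radon's relation: the areas of the four triangles
  formed by the vertices of a convex quadrilateral.\<close>

lemma diagonals_meet:
  assumes "0 < orient r u i" "0 < orient u i v" "0 < orient r i v" "0 < orient r u v"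
  shows "closed_segment u v \<inter> closed_segment i r \<noteq> {}"
proof -
  define S where "S = orient r u i + orient r i v"
  have S: "S > 0" "S = orient u i v + orient r u v"
    using assms by (auto simp: S_def orient_def algebra_simps)
  define t s where "t = orient r u i / S" and "s = orient u i v / S"
  have range: "0 \<le> t" "t \<le> 1" "0 \<le> s" "s \<le> 1"
    using assms S by (auto simp: t_def s_def S_def divide_simps)
  have "S *\<^sub>R ((1 - t) *\<^sub>R u + t *\<^sub>R v) = (S * (1 - t)) *\<^sub>R u + (S * t) *\<^sub>R v"
    by (simp add: scaleR_add_right)
  also have "\<dots> = orient r i v *\<^sub>R u + orient r u i *\<^sub>R v"
    using S(1) by (simp add: t_def right_diff_distrib) (simp add: S_def)
  also have "\<dots> = orient r u v *\<^sub>R i + orient u i v *\<^sub>R r"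
    by (simp add: complex_eq_iff orient_def algebra_simps)
  also have "\<dots> = (S * (1 - s)) *\<^sub>R i + (S * s) *\<^sub>R r"
    using S(1) by (simp add: s_def right_diff_distrib) (simp add: S(2))
  also have "\<dots> = S *\<^sub>R ((1 - s) *\<^sub>R i + s *\<^sub>R r)"
    by (simp add: scaleR_add_right)
  finally have "(1 - t) *\<^sub>R u + t *\<^sub>R v = (1 - s) *\<^sub>R i + s *\<^sub>R r"
    using S(1) by simp
  with range show ?thesis unfolding closed_segment_def by blast
qed

text \<open>The signed distance from the line \<open>x y\<close> is affine along the segment from
  \<open>i\<close> to \<open>r\<close> and grows from \<open>i\<close> to \<open>r\<close>, so
  comparing its values compares the parameters of \<open>p\<close> and \<open>q\<close>.\<close>

lemma dist_less_of_orient: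
  assumes "p \<in> closed_segment i r" "q \<in> closed_segment i r"
    and "orient x y p < orient x y q" "orient x y i < orient x y r"
  shows "dist i p < dist i q"
proof -
  obtain s where s: "0 \<le> s" "p = (1 - s) *\<^sub>R i + s *\<^sub>R r" using assms(1) by (rule in_segmentE)
  obtain t where t: "0 \<le> t" "q = (1 - t) *\<^sub>R i + t *\<^sub>R r" using assms(2) by (rule in_segmentE)
  have d: "dist i ((1 - s) *\<^sub>R i + s *\<^sub>R r) = s * dist i r" if "0 \<le> s" for s
  proof -
    have "i - ((1 - s) *\<^sub>R i + s *\<^sub>R r) = s *\<^sub>R (i - r)" by (simp add: algebra_simps)
    then show ?thesis using that by (simp add: dist_norm)
  qed
  have "0 < (t - s) * (orient x y r - orient x y i)"
    using assms(3) unfolding s(2) t(2) orient_affine by (simp add: algebra_simps)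
  then have "s < t" using assms(4) by (simp add: zero_less_mult_iff)
  moreover have "0 < dist i r" using assms(4) by auto
  ultimately show ?thesis using d s t by simp
qed

locale polygon_triangulation = rooted_triangulation V f r D
  for V :: "nat set" and f r D +
  fixes P :: "nat \<Rightarrow> complex"
  assumes orient_pos: "a \<in> V \<Longrightarrow> b \<in> V \<Longrightarrow> c \<in> V \<Longrightarrow> f a < f b \<Longrightarrow> f b < f c \<Longrightarrow>
    0 < orient (P a) (P b) (P c)"
begin

section \<open>Crossing points of chords in terms of ranks\<close>

lemma orient_nonzero:
  assumes "a \<in> V" "b \<in> V" "c \<in> V" "a \<noteq> b" "b \<noteq> c" "a \<noteq> c"
  shows "orient (P a) (P b) (P c) \<noteq> 0"
proof -
  have "f a \<noteq> f b" "f b \<noteq> f c" "f a \<noteq> f c" using assms rank_eq by auto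
  then consider "f a < f b" "f b < f c" | "f b < f c" "f c < f a" | "f c < f a" "f a < f b"
    | "f c < f b" "f b < f a" | "f b < f a" "f a < f c" | "f a < f c" "f c < f b"
    by linarith
  then show ?thesis
    using orient_pos[of a b c] orient_pos[of b c a] orient_pos[of c a b] orient_pos[of c b a]
      orient_pos[of b a c] orient_pos[of a c b] assms
      orient_rotate orient_flip
    by cases (metis less_irrefl neg_0_less_iff_less orient_flip orient_rotate)+
qed

lemma rank_pos_iff: "a \<in> V \<Longrightarrow> 0 < f a \<longleftrightarrow> a \<noteq> r"
  using rank_eq[of a r] root by auto

text \<open>If \<open>i\<close> is not separated, \<open>a\<close> and \<open>b\<close> lie strictly
  on one side of the line through \<open>P i\<close> and \<open>P r\<close>, and so does the whole
  segment between them.\<close>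

lemma separates_of_chords_meet:
  assumes "i \<in> V" "a \<in> V" "b \<in> V" "i \<noteq> r" "{a, b} \<inter> {i, r} = {}"
    and "chord P a b \<inter> chord P i r \<noteq> {}"
  shows "separates i (a, b)"
proof (rule ccontr)
  assume ns: "\<not> separates i (a, b)"
  obtain p where p: "p \<in> closed_segment (P a) (P b)" "p \<in> closed_segment (P i) (P r)"
    using assms(6) by (auto simp: chord_def)
  have zero: "orient (P i) (P r) p = 0" "orient (P r) (P i) p = 0"
    using orient_on_segment[OF p(2)] orient_flip[of "P i" "P r" p] by simp_all
  have pos: "0 < f a" "0 < f b" "0 < f i" using assms rank_pos_iff by auto
  have ne: "f a \<noteq> f i" "f b \<noteq> f i" using assms rank_eq by auto
  consider "f i < f a" "f i < f b" | "f a < f i" "f b < f i"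
    using ns pos ne by (auto simp: separates_def)
  then show False
  proof cases
    case 1
    then have "0 < orient (P r) (P i) p"
      using pos assms root by (intro segment_orient_pos[OF p(1)] orient_pos) auto
    with zero show False by simp
  next
    case 2
    then have "0 < orient (P r) (P a) (P i)" "0 < orient (P r) (P b) (P i)"
      using pos assms root by (auto intro!: orient_pos)
    then have "0 < orient (P i) (P r) p"
      by (intro segment_orient_pos[OF p(1)]) (simp_all add: orient_rotate[of "P i"])
    with zero show False by simp
  qed
qed

lemma chords_meet_of_separates:
  assumes "i \<in> V" "a \<in> V" "b \<in> V" "separates i (a, b)"
  shows "chord P a b \<inter> chord P i r \<noteq> {}"
proof -
  obtain u v where uv: "(a, b) = (u, v) \<or> (a, b) = (v, u)" "0 < f u" "f u < f i" "f i < f v"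
    using assms(4) by (rule separates_cases)
  then have "u \<in> V" "v \<in> V" using assms by auto
  then have "closed_segment (P u) (P v) \<inter> closed_segment (P i) (P r) \<noteq> {}"
    using uv assms root by (intro diagonals_meet orient_pos) auto
  with uv(1) show ?thesis by (auto simp: chord_def closed_segment_commute)
qed

text \<open>The line through the wider chord has \<open>P i\<close> and \<open>P r\<close> on
  opposite sides. The point \<open>q\<close> lies on that line, while \<open>p\<close>, on the
  narrower chord, lies strictly on the side of \<open>P i\<close>.\<close>

lemma dist_less_of_width_less:
  assumes "i \<in> V" "c \<in> D" "d \<in> D" "separates i c" "separates i d" "width c < width d"
    and "p \<in> chord P (fst c) (snd c) \<inter> chord P i r" "q \<in> chord P (fst d) (snd d) \<inter> chord P i r"
  shows "dist (P i) p < dist (P i) q"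
proof -
  obtain u v x y where *: "{fst c, snd c} = {u, v}" "{fst d, snd d} = {x, y}"
    "0 < f x" "f x \<le> f u" "f u < f i" "f i < f v" "f v \<le> f y" "f x < f u \<or> f v < f y"
    by (rule separates_width_nested[OF assms(2-6)])
  have V: "u \<in> V" "v \<in> V" "x \<in> V" "y \<in> V"
    using *(1,2) D_V[of "fst c" "snd c"] D_V[of "fst d" "snd d"] assms(2,3)
    by (auto simp: doubleton_eq_iff)
  have p: "p \<in> closed_segment (P u) (P v)" "p \<in> closed_segment (P i) (P r)"
    and q: "q \<in> closed_segment (P x) (P y)" "q \<in> closed_segment (P i) (P r)"
    using *(1,2) assms(7,8) by (auto simp: chord_def doubleton_eq_iff closed_segment_commute)
  have inside: "orient (P x) (P y) (P z) < 0" if "z \<in> V" "f x < f z" "f z < f y" for z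
    using orient_pos[of x z y] that V orient_flip orient_rotate
    by (metis neg_0_less_iff_less)
  have r_pos: "0 < orient (P x) (P y) (P r)"
    using orient_pos[of r x y] * V root orient_rotate[of "P r" "P x" "P y"] by simp
  have i_neg: "orient (P x) (P y) (P i) < 0" using inside[of i] * assms(1) by simp
  have off: "P z \<notin> closed_segment (P i) (P r)" if "z \<in> V" "z \<noteq> i" "z \<noteq> r" for z
    using orient_nonzero[of i r z] that assms(1) root * orient_on_segment by fastforce
  obtain t where t: "0 \<le> t" "t \<le> 1" "p = (1 - t) *\<^sub>R P u + t *\<^sub>R P v"
    using p(1) by (rule in_segmentE)
  have ne: "u \<noteq> i" "u \<noteq> r" "v \<noteq> i" "v \<noteq> r" using *(3-6) root(2) by auto
  \<comment> \<open>The two chords may share one endpoint, so strictness on one side requires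
    \<open>p\<close> to be an inner point of its chord.\<close>
  have "t \<noteq> 0" using t(3) p(2) off[OF V(1) ne(1,2)] by auto
  moreover have "t \<noteq> 1" using t(3) p(2) off[OF V(2) ne(3,4)] by auto
  ultimately have t': "0 < t" "t < 1" using t by auto
  have u_le: "orient (P x) (P y) (P u) < 0 \<or> u = x"
  proof (cases "f x < f u")
    case True
    then show ?thesis using inside[OF V(1)] *(4-7) by simp
  next
    case False
    then have "f u = f x" using *(4) by simp
    then show ?thesis using rank_eq[OF V(1,3)] by simp
  qed
  have v_le: "orient (P x) (P y) (P v) < 0 \<or> v = y"
  proof (cases "f v < f y")
    case True
    then show ?thesis using inside[OF V(2)] *(4-7) by simp
  next
    case False
    then have "f v = f y" using *(7) by simp
    then show ?thesis using rank_eq[OF V(2,4)] by simp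
  qed
  have "orient (P x) (P y) p < 0"
  proof (cases "u = x")
    case True
    then have "v \<noteq> y" using *(8) by auto
    then show ?thesis using v_le t' True by (simp add: t(3) orient_affine mult_pos_neg)
  next
    case False
    then have "(1 - t) * orient (P x) (P y) (P u) < 0" using u_le t' by (simp add: mult_pos_neg)
    moreover have "t * orient (P x) (P y) (P v) \<le> 0"
      using v_le t' by (auto simp: mult_le_0_iff)
    ultimately show ?thesis by (simp add: t(3) orient_affine)
  qed
  moreover have "orient (P x) (P y) q = 0" using orient_on_segment[OF q(1)] .
  ultimately show ?thesis
    using i_neg r_pos by (intro dist_less_of_orient[OF p(2) q(2), of "P x" "P y"]) auto
qed

section \<open>Equivalence of the geometric and the rank form of admissibility\<close>

definition meets :: "nat \<Rightarrow> nat \<times> nat \<Rightarrow> bool" where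
  "meets i e \<longleftrightarrow> chord P (fst e) (snd e) \<inter> chord P i r \<noteq> {}"

definition before :: "nat \<Rightarrow> nat \<times> nat \<Rightarrow> nat \<times> nat \<Rightarrow> bool" where
  "before i c d \<longleftrightarrow> (\<forall>p \<in> chord P (fst c) (snd c) \<inter> chord P i r.
     \<forall>q \<in> chord P (fst d) (snd d) \<inter> chord P i r. dist (P i) p < dist (P i) q)"

lemma beforeD:
  assumes "before i c d" "p \<in> chord P (fst c) (snd c)" "p \<in> chord P i r"
    "q \<in> chord P (fst d) (snd d)" "q \<in> chord P i r"
  shows "dist (P i) p < dist (P i) q"
  using assms unfolding before_def by blast

lemma separates_of_meets:
  assumes "i \<in> V" "i \<noteq> r" "e \<in> D" "meets i e" "{fst e, snd e} \<inter> {i, r} = {}"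
  shows "separates i e"
  using separates_of_chords_meet[OF assms(1), of "fst e" "snd e"] assms(2-) D_V[of "fst e" "snd e"]
  by (auto simp: meets_def)

lemma meets_of_separates:
  assumes "i \<in> V" "e \<in> D" "separates i e"
  shows "meets i e"
  using chords_meet_of_separates[OF assms(1), of "fst e" "snd e"] assms(2-) D_V[of "fst e" "snd e"]
  by (auto simp: meets_def)

lemma width_less_of_before:
  assumes "i \<in> V" "c \<in> D" "d \<in> D" "separates i c" "separates i d" "before i c d"
  shows "width c < width d"
proof (rule ccontr)
  assume nless: "\<not> width c < width d"
  obtain p where p: "p \<in> chord P (fst c) (snd c) \<inter> chord P i r"
    using meets_of_separates[OF assms(1,2,4)] unfolding meets_def by blast
  obtain q where q: "q \<in> chord P (fst d) (snd d) \<inter> chord P i r"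
    using meets_of_separates[OF assms(1,3,5)] unfolding meets_def by blast
  have less: "dist (P i) p < dist (P i) q" if "p \<in> chord P (fst c) (snd c) \<inter> chord P i r" for p
    using assms(6) that q unfolding before_def by blast
  consider "width d < width c" | "width c = width d" using nless by linarith
  then show False
  proof cases
    case 1
    then show False
      using dist_less_of_width_less[OF assms(1,3,2,5,4) _ q p] less[OF p] by simp
  next
    case 2
    then have "chord P (fst c) (snd c) = chord P (fst d) (snd d)"
      using separates_width_eq[OF assms(2-5)]
      by (auto simp: chord_def doubleton_eq_iff closed_segment_commute)
    then show False using less[of q] q by simp
  qed
qed

lemma endpoint_in_chord: "P a \<in> chord P a b" "P b \<in> chord P a b"
  by (simp_all add: chord_def)

context
  fixes i t
  assumes i: "i \<in> V" "i \<noteq> r" and t: "t \<noteq> []" and D: "set (edges (i # t @ [r])) \<subseteq> D"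
begin

lemma edges_path: "edges (i # t @ [r]) = (i, hd t) # edges t @ [(last t, r)]"
  by (rule edges_Cons_snoc[OF t])

lemma path_D: "set (edges t) \<subseteq> D" "(i, hd t) \<in> D" "(last t, r) \<in> D"
  using D unfolding edges_path by auto

text \<open>The first step contains \<open>P i\<close> and the last contains \<open>P r\<close>. The
  strict order therefore forbids every step in between to touch either end, and a tested step that
  meets the diagonal must cross it properly.\<close>

lemma adm_of_geometric:
  assumes alt: "alternating (meets i) (i # t @ [r])"
    and ord: "sorted_wrt (before i) (edges (i # t @ [r]))"
  shows "i # t @ [r] \<in> adm i"
proof -
  have disj: "{fst e, snd e} \<inter> {i, r} = {}" if "e \<in> set (edges t)" for e
  proof -
    have b: "before i (i, hd t) e" "before i e (last t, r)"
      using ord that unfolding edges_path by (auto simp: sorted_wrt_append)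
    have "P i \<notin> chord P (fst e) (snd e)"
    proof
      assume "P i \<in> chord P (fst e) (snd e)"
      then have "dist (P i) (P i) < dist (P i) (P i)"
        using beforeD[OF b(1), of "P i" "P i"] endpoint_in_chord by simp
      then show False by simp
    qed
    moreover have "P r \<notin> chord P (fst e) (snd e)"
    proof
      assume "P r \<in> chord P (fst e) (snd e)"
      then have "dist (P i) (P r) < dist (P i) (P r)"
        using beforeD[OF b(2), of "P r" "P r"] endpoint_in_chord by simp
      then show False by simp
    qed
    ultimately show ?thesis using endpoint_in_chord by (cases e) auto
  qed
  have "alternating (separates i) (i # t @ [r])"
  proof (rule alternating_mono[OF alt])
    fix e assume "e \<in> set (edges (butlast (tl (i # t @ [r]))))" "meets i e"
    then show "separates i e" using separates_of_meets[OF i, of e] disj[of e] path_D(1) by auto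
  qed
  moreover have "sorted_wrt (\<lambda>c d. separates i c \<longrightarrow> separates i d \<longrightarrow> width c < width d)
      (edges (i # t @ [r]))"
    by (rule sorted_wrt_mono_rel[OF _ ord]) (use width_less_of_before[OF i(1)] D in blast)
  ultimately show ?thesis using D by (simp add: adm_def)
qed

text \<open>By general position the first step meets the diagonal only in \<open>P i\<close> and the
  last only in \<open>P r\<close>. Inner vertices differ from \<open>i\<close> and \<open>r\<close>,
  so an inner step that meets the diagonal separates \<open>i\<close>, and widths order the crossing
  points.\<close>

lemma geometric_of_adm:
  assumes adm: "i # t @ [r] \<in> adm i"
  shows "alternating (meets i) (i # t @ [r])" "sorted_wrt (before i) (edges (i # t @ [r]))"
proof -
  have alt: "alternating (separates i) (i # t @ [r])"
    and ord: "sorted_wrt (\<lambda>c d. separates i c \<longrightarrow> separates i d \<longrightarrow> width c < width d)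
      ((i, hd t) # edges t @ [(last t, r)])"
    using adm unfolding edges_path[symmetric] by (simp_all add: adm_def)
  show "alternating (meets i) (i # t @ [r])"
  proof (rule alternating_mono[OF alt])
    fix e assume "e \<in> set (edges (butlast (tl (i # t @ [r]))))" "separates i e"
    then show "meets i e" using meets_of_separates[OF i(1), of e] path_D(1) by auto
  qed
  have t_avoids: "x \<noteq> i \<and> x \<noteq> r" if x: "x \<in> set t" for x
  proof -
    obtain u where "separates i (u, x) \<or> separates i (x, u)"
      using alternating_inner_vertex[OF alt, of x] x by auto
    then show ?thesis using root by (auto simp: separates_def)
  qed
  have disj: "{fst e, snd e} \<inter> {i, r} = {}" if "e \<in> set (edges t)" for e
    using edges_subset[of t] that t_avoids by (cases e) auto
  have off: "P z \<notin> chord P (fst e) (snd e)" if e: "e \<in> set (edges t)" and z: "z = i \<or> z = r" for e z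
  proof -
    have "(fst e, snd e) \<in> D" using e path_D(1) by auto
    then have "orient (P (fst e)) (P (snd e)) (P z) \<noteq> 0"
      using disj[OF e] z i root D_V[of "fst e" "snd e"] by (intro orient_nonzero) auto
    then show ?thesis using orient_on_segment unfolding chord_def by blast
  qed
  have ends: "hd t \<in> V" "hd t \<noteq> i" "hd t \<noteq> r" "last t \<in> V" "last t \<noteq> i" "last t \<noteq> r"
    using D_V[OF path_D(2)] D_V[OF path_D(3)] t_avoids t by auto
  have at_i: "p = P i" if "p \<in> chord P i (hd t)" "p \<in> chord P i r" for p
    using that i root ends unfolding chord_def
    by (intro segments_common_endpoint[of "P i" "P (hd t)" "P r"] orient_nonzero) auto
  have at_r: "p = P r" if "p \<in> chord P (last t) r" "p \<in> chord P i r" for p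
    using that i root ends unfolding chord_def
    by (intro segments_common_endpoint[of "P r" "P (last t)" "P i"] orient_nonzero)
       (auto simp: closed_segment_commute)
  have P_ne: "P i \<noteq> P r"
    using orient_nonzero[of i r "hd t"] ends i root by auto
  have far: "dist (P i) p < dist (P i) (P r)" if p: "p \<in> chord P i r" "p \<noteq> P r" for p
  proof -
    obtain s where s: "0 \<le> s" "s \<le> 1" "p = (1 - s) *\<^sub>R P i + s *\<^sub>R P r"
      using p(1) unfolding chord_def by (rule in_segmentE)
    then have "s \<noteq> 1" using p(2) by auto
    have "P i - p = s *\<^sub>R (P i - P r)" using s(3) by (simp add: algebra_simps)
    then have "dist (P i) p = s * dist (P i) (P r)" using s(1) by (simp add: dist_norm)
    then show ?thesis using s(2) \<open>s \<noteq> 1\<close> P_ne by simp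
  qed
  have "before i (i, hd t) e" if e: "e \<in> set (edges t)" for e
    unfolding before_def
  proof (intro ballI)
    fix p q assume "p \<in> chord P (fst (i, hd t)) (snd (i, hd t)) \<inter> chord P i r"
      and "q \<in> chord P (fst e) (snd e) \<inter> chord P i r"
    then have "p = P i" "q \<noteq> P i" using at_i off[OF e, of i] by auto
    then show "dist (P i) p < dist (P i) q" by simp
  qed
  moreover have "before i e (last t, r)" if e: "e \<in> set (edges t)" for e
    unfolding before_def
  proof (intro ballI)
    fix p q assume "p \<in> chord P (fst e) (snd e) \<inter> chord P i r"
      and "q \<in> chord P (fst (last t, r)) (snd (last t, r)) \<inter> chord P i r"
    then have "p \<in> chord P i r" "p \<noteq> P r" "q = P r" using at_r off[OF e, of r] by auto
    then show "dist (P i) p < dist (P i) q" using far by simp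
  qed
  moreover have "before i (i, hd t) (last t, r)"
    unfolding before_def
  proof (intro ballI)
    fix p q assume "p \<in> chord P (fst (i, hd t)) (snd (i, hd t)) \<inter> chord P i r"
      and "q \<in> chord P (fst (last t, r)) (snd (last t, r)) \<inter> chord P i r"
    then have "p = P i" "q = P r" using at_i at_r by auto
    then show "dist (P i) p < dist (P i) q" using P_ne by simp
  qed
  moreover have "sorted_wrt (before i) (edges t)"
  proof (rule sorted_wrt_mono_rel)
    show "sorted_wrt (\<lambda>c d. separates i c \<longrightarrow> separates i d \<longrightarrow> width c < width d) (edges t)"
      using ord by (simp add: sorted_wrt_append)
    fix c d assume cd: "c \<in> set (edges t)" "d \<in> set (edges t)"
      "separates i c \<longrightarrow> separates i d \<longrightarrow> width c < width d"
    show "before i c d"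
      unfolding before_def
    proof (intro ballI)
      fix p q assume p: "p \<in> chord P (fst c) (snd c) \<inter> chord P i r"
        and q: "q \<in> chord P (fst d) (snd d) \<inter> chord P i r"
      have cD: "c \<in> D" "d \<in> D" using cd(1,2) path_D(1) by auto
      have "meets i c" "meets i d" using p q unfolding meets_def by blast+
      then have "separates i c" "separates i d"
        using separates_of_meets[OF i] cD disj[OF cd(1)] disj[OF cd(2)] by blast+
      with cd(3) show "dist (P i) p < dist (P i) q"
        using dist_less_of_width_less[OF i(1) cD _ _ _ p q] by blast
    qed
  qed
  ultimately show "sorted_wrt (before i) (edges (i # t @ [r]))"
    unfolding edges_path by (auto simp: sorted_wrt_append)
qed

end

lemma alternating_length_two:
  assumes "alternating Q w" "\<nexists>t. t \<noteq> [] \<and> w = hd w # t @ [last w]"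
  shows "w = [hd w, last w]"
  using assms(1)
proof (cases rule: alternating_cases)
  case (2 a b c s)
  then have "w = hd w # (b # butlast (c # s)) @ [last w]" by simp
  with assms(2) show ?thesis by blast
qed simp

lemma geometric_iff_adm:
  assumes i: "i \<in> V" "i \<noteq> r"
  shows "hd w = i \<and> last w = r \<and> set (edges w) \<subseteq> D \<and> alternating (meets i) w \<and>
    sorted_wrt (before i) (edges w) \<longleftrightarrow> w \<in> adm i" (is "?geo \<longleftrightarrow> _")
proof (cases "hd w = i \<and> last w = r \<and> set (edges w) \<subseteq> D")
  case True
  show ?thesis
  proof (cases "\<exists>t. t \<noteq> [] \<and> w = hd w # t @ [last w]")
    case long: True
    then obtain t where w: "w = i # t @ [r]" "t \<noteq> []" using True by auto
    have D: "set (edges (i # t @ [r])) \<subseteq> D" using True w(1) by simp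
    show ?thesis
      using adm_of_geometric[OF i w(2) D] geometric_of_adm[OF i w(2) D] True
      unfolding w(1)[symmetric] by blast
  next
    case False
    show ?thesis
    proof (cases "w = [i, r]")
      case w: True
      \<comment> \<open>The single step lies along the diagonal itself; with one edge there is
        nothing to order or to test.\<close>
      then show ?thesis using True by (simp add: adm_def)
    next
      case ne: False
      then have "\<not> alternating Q w" for Q
        using alternating_length_two[OF _ False, of Q] True by metis
      then show ?thesis by (simp add: adm_def)
    qed
  qed
qed (auto simp: adm_def)

end

section \<open>The expansion in the polygon algebra\<close>

lemma monomial_carrier: "set u \<subseteq> G \<Longrightarrow> monomial u \<in> carrier (free_algebra G)"
  by (auto simp: free_algebra_def monomial_def)

lemma monomial_one: "\<one>\<^bsub>free_algebra G\<^esub> = monomial []"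
  by (auto simp: free_algebra_def monomial_def)

lemma monomial_mult: "monomial u \<otimes>\<^bsub>free_algebra G\<^esub> monomial v = monomial (u @ v)"
proof
  fix w
  have "(\<Sum>k\<le>length w. monomial u (take k w) * monomial v (drop k w))
      = (\<Sum>k\<le>length w. if k = length u then monomial (u @ v) w else 0)"
  proof (rule sum.cong)
    fix k assume k: "k \<in> {..length w}"
    have "take k w = u \<and> drop k w = v \<longleftrightarrow> k = length u \<and> w = u @ v"
    proof
      assume *: "take k w = u \<and> drop k w = v"
      then have "length u = k" using k by auto
      with * show "k = length u \<and> w = u @ v" by (metis append_take_drop_id)
    qed simp
    moreover have "monomial u (take k w) * monomial v (drop k w)
        = (if take k w = u \<and> drop k w = v then 1 else 0)"
      by (simp add: monomial_def)
    ultimately show "monomial u (take k w) * monomial v (drop k w)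
        = (if k = length u then monomial (u @ v) w else 0)"
      by (simp only:) (simp add: monomial_def)
  qed simp
  also have "\<dots> = monomial (u @ v) w" by (auto simp: monomial_def)
  finally show "(monomial u \<otimes>\<^bsub>free_algebra G\<^esub> monomial v) w = monomial (u @ v) w"
    by (simp add: free_algebra_def)
qed

lemma symbols_iff [simp]:
  "X i j \<in> symbols n \<longleftrightarrow> (i, j) \<in> chords n" "Xinv i j \<in> symbols n \<longleftrightarrow> (i, j) \<in> chords n"
  by (auto simp: symbols_def)

lemma relators_carrier:
  "inverse_relators n \<union> triangle_relators n \<union> exchange_relators n \<subseteq> carrier (FA n)"
proof -
  interpret ring "FA n" by (rule ring_free_algebra)
  have "inverse_relators n \<subseteq> carrier (FA n)"
    by (auto simp: inverse_relators_def monomial_one intro!: minus_closed monomial_carrier)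
  moreover have "triangle_relators n \<subseteq> carrier (FA n)"
    by (auto simp: triangle_relators_def chords_def intro!: minus_closed monomial_carrier)
  moreover have "exchange_relators n \<subseteq> carrier (FA n)"
    by (auto simp: exchange_relators_def chords_def cyclic_def intro!: minus_closed a_closed monomial_carrier)
  ultimately show ?thesis by blast
qed

lemma ideal_relation_ideal: "ideal (relation_ideal n) (FA n)"
  unfolding relation_ideal_def
  by (rule ring.genideal_ideal[OF ring_free_algebra relators_carrier])

lemma ring_polygon_algebra: "ring (polygon_algebra n)"
  unfolding polygon_algebra_def by (rule ideal.quotient_is_ring[OF ideal_relation_ideal])

definition alg_class :: "nat \<Rightarrow> (symbol list \<Rightarrow> rat) \<Rightarrow> (symbol list \<Rightarrow> rat) set" where
  "alg_class n a = relation_ideal n +>\<^bsub>FA n\<^esub> a"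

lemma alg_class_hom: "ring_hom_ring (FA n) (polygon_algebra n) (alg_class n)"
  unfolding polygon_algebra_def alg_class_def by (rule ideal.rcos_ring_hom_ring[OF ideal_relation_ideal])

lemma alg_class_eqI:
  assumes "a \<ominus>\<^bsub>FA n\<^esub> b \<in> inverse_relators n \<union> triangle_relators n \<union> exchange_relators n"
    and "a \<in> carrier (FA n)" "b \<in> carrier (FA n)"
  shows "alg_class n a = alg_class n b"
proof -
  interpret ring "FA n" by (rule ring_free_algebra)
  have "a \<ominus>\<^bsub>FA n\<^esub> b \<in> relation_ideal n"
    using genideal_self[OF relators_carrier] assms(1) unfolding relation_ideal_def by blast
  then show ?thesis
    using quotient_eq_iff_same_a_r_cos[OF ideal_relation_ideal assms(2,3)] unfolding alg_class_def by simp
qed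

lemma x_chord_carrier: "(i, j) \<in> chords n \<Longrightarrow> x_chord n i j \<in> carrier (polygon_algebra n)"
  and x_chord_inv_carrier: "(i, j) \<in> chords n \<Longrightarrow> x_chord_inv n i j \<in> carrier (polygon_algebra n)"
proof -
  interpret ring_hom_ring "FA n" "polygon_algebra n" "alg_class n" by (rule alg_class_hom)
  assume "(i, j) \<in> chords n"
  then show "x_chord n i j \<in> carrier (polygon_algebra n)"
    "x_chord_inv n i j \<in> carrier (polygon_algebra n)"
    unfolding x_chord_def x_chord_inv_def alg_class_def[symmetric]
    by (auto intro!: hom_closed monomial_carrier)
qed

lemma alg_class_mult:
  assumes "set u \<subseteq> symbols n" "set v \<subseteq> symbols n"
  shows "alg_class n (monomial (u @ v)) = alg_class n (monomial u) \<otimes>\<^bsub>polygon_algebra n\<^esub> alg_class n (monomial v)"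
proof -
  interpret ring_hom_ring "FA n" "polygon_algebra n" "alg_class n" by (rule alg_class_hom)
  show ?thesis using assms by (simp add: monomial_mult[of "symbols n" u v, symmetric] hom_mult monomial_carrier)
qed

lemma x_chord_inverse:
  assumes "(i, j) \<in> chords n"
  shows "x_chord_inv n i j \<otimes>\<^bsub>polygon_algebra n\<^esub> x_chord n i j = \<one>\<^bsub>polygon_algebra n\<^esub>"
proof -
  interpret ring_hom_ring "FA n" "polygon_algebra n" "alg_class n" by (rule alg_class_hom)
  have "alg_class n (monomial [Xinv i j, X i j]) = alg_class n \<one>\<^bsub>FA n\<^esub>"
    using assms by (intro alg_class_eqI) (auto simp: inverse_relators_def monomial_carrier monomial_one)
  then show ?thesis
    using alg_class_mult[of "[Xinv i j]" n "[X i j]"] assms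
    by (simp add: x_chord_def x_chord_inv_def alg_class_def[symmetric])
qed

lemma exchange:
  assumes "cyclic n [i, j, k, l]"
  shows "x_chord n j l =
    x_chord n j k \<otimes>\<^bsub>polygon_algebra n\<^esub> x_chord_inv n i k \<otimes>\<^bsub>polygon_algebra n\<^esub> x_chord n i l
    \<oplus>\<^bsub>polygon_algebra n\<^esub>
    x_chord n j i \<otimes>\<^bsub>polygon_algebra n\<^esub> x_chord_inv n k i \<otimes>\<^bsub>polygon_algebra n\<^esub> x_chord n k l"
proof -
  interpret ring_hom_ring "FA n" "polygon_algebra n" "alg_class n" by (rule alg_class_hom)
  let ?u = "[X j k, Xinv i k, X i l]" and ?v = "[X j i, Xinv k i, X k l]"
  have ch: "(j, l) \<in> chords n" "(j, k) \<in> chords n" "(i, k) \<in> chords n" "(i, l) \<in> chords n"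
    "(j, i) \<in> chords n" "(k, i) \<in> chords n" "(k, l) \<in> chords n"
    using assms by (auto simp: cyclic_def chords_def)
  have C: "monomial ?u \<in> carrier (FA n)" "monomial ?v \<in> carrier (FA n)"
    using ch by (auto intro!: monomial_carrier)
  have three: "alg_class n (monomial [a, b, c]) = alg_class n (monomial [a]) \<otimes>\<^bsub>polygon_algebra n\<^esub>
      alg_class n (monomial [b]) \<otimes>\<^bsub>polygon_algebra n\<^esub> alg_class n (monomial [c])"
    if "{a, b, c} \<subseteq> symbols n" for a b c
    using that alg_class_mult[of "[a]" n "[b]"] alg_class_mult[of "[a, b]" n "[c]"] by simp
  have "alg_class n (monomial [X j l]) = alg_class n (monomial ?u \<oplus>\<^bsub>FA n\<^esub> monomial ?v)"
  proof (rule alg_class_eqI)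
    show "monomial [X j l] \<ominus>\<^bsub>FA n\<^esub> (monomial ?u \<oplus>\<^bsub>FA n\<^esub> monomial ?v)
        \<in> inverse_relators n \<union> triangle_relators n \<union> exchange_relators n"
      using assms unfolding exchange_relators_def by blast
  qed (use ch C in \<open>auto intro!: monomial_carrier\<close>)
  also have "\<dots> = alg_class n (monomial ?u) \<oplus>\<^bsub>polygon_algebra n\<^esub> alg_class n (monomial ?v)"
    using C by (rule hom_add)
  finally show ?thesis
    using ch three[of "X j k" "Xinv i k" "X i l"] three[of "X j i" "Xinv k i" "X k l"]
    by (simp add: x_chord_def x_chord_inv_def alg_class_def[symmetric])
qed

lemma chords_sym: "(i, j) \<in> chords n \<longleftrightarrow> (j, i) \<in> chords n"
  by (auto simp: chords_def)

lemma x_seq_carrier: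
  "set (edges w) \<subseteq> chords n \<Longrightarrow> x_seq n w \<in> carrier (polygon_algebra n)"
proof (induction n w rule: x_seq.induct)
  case (4 n a b c s)
  interpret ring "polygon_algebra n" by (rule ring_polygon_algebra)
  show ?case using 4 chords_sym[of b c n]
    by (auto intro!: m_closed x_chord_carrier x_chord_inv_carrier)
qed (auto simp: x_chord_carrier ring_polygon_algebra ring.ring_simprules)

text \<open>If \<open>w\<close> starts with \<open>(b, a)\<close>, its first factor cancels the
  inverse in the prefix; otherwise the equation is the recursion of \<open>x_seq\<close>. The
  sequence \<open>[b, r]\<close> belongs to the second kind because
  \<open>r \<noteq> a\<close>.\<close>

lemma x_seq_reroute:
  fixes V :: "nat set"
  assumes "first_triangle V f r D i a b" "D \<subseteq> chords n" "w \<in> rooted_triangulation.adm f r D b"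
  shows "x_seq n (reroute i a w) =
    x_chord n i a \<otimes>\<^bsub>polygon_algebra n\<^esub> x_chord_inv n b a \<otimes>\<^bsub>polygon_algebra n\<^esub> x_seq n w"
proof -
  interpret A: ring "polygon_algebra n" by (rule ring_polygon_algebra)
  interpret first_triangle V f r D i a b by (rule assms(1))
  have w: "hd w = b" "last w = r" "set (edges w) \<subseteq> chords n" "alternating (separates b) w"
    using assms by (auto simp: adm_def)
  have ch: "(i, a) \<in> chords n" "(b, a) \<in> chords n" using assms ab ia sym by auto
  from w(4) show ?thesis
  proof (cases rule: alternating_cases)
    case (1 b' r')
    then show ?thesis using w(1,2) vertices_distinct by (auto simp: reroute_def)
  next
    case (2 b' x c s)
    then have w_eq: "w = b # x # c # s" using w by simp
    show ?thesis
    proof (cases "x = a")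
      case True
      let ?y = "x_chord_inv n c a \<otimes>\<^bsub>polygon_algebra n\<^esub> x_seq n (c # s)"
      have "(c, a) \<in> chords n" "set (edges (c # s)) \<subseteq> chords n"
        using w(3) w_eq True chords_sym[of a c n] by auto
      then have C: "x_chord_inv n c a \<in> carrier (polygon_algebra n)"
        "x_seq n (c # s) \<in> carrier (polygon_algebra n)"
        "x_chord n i a \<in> carrier (polygon_algebra n)"
        "x_chord_inv n b a \<in> carrier (polygon_algebra n)"
        "x_chord n b a \<in> carrier (polygon_algebra n)"
        using ch by (simp_all add: x_chord_carrier x_chord_inv_carrier x_seq_carrier)
      have "x_chord n i a \<otimes>\<^bsub>polygon_algebra n\<^esub> x_chord_inv n b a \<otimes>\<^bsub>polygon_algebra n\<^esub> x_seq n w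
          = x_chord n i a \<otimes>\<^bsub>polygon_algebra n\<^esub>
            (x_chord_inv n b a \<otimes>\<^bsub>polygon_algebra n\<^esub> x_chord n b a) \<otimes>\<^bsub>polygon_algebra n\<^esub> ?y"
        using C by (simp add: w_eq True A.m_assoc)
      also have "\<dots> = x_seq n (reroute i a w)"
        using C x_chord_inverse[OF ch(2)] by (simp add: w_eq True reroute_def A.m_assoc)
      finally show ?thesis by simp
    next
      case False
      then show ?thesis using w_eq by (simp add: reroute_def)
    qed
  qed
qed

text \<open>Finiteness is carried through the induction because \<open>finsum\<close> over an
  infinite set defaults to zero, and both splitting the sum and distributing over it need finite
  index sets.\<close>

lemma (in polygon_triangulation) laurent_expansion:
  assumes D: "D \<subseteq> chords n" and V: "V = {1..n}"
    and cyc: "\<And>a i b. {a, i, b} \<subseteq> V \<Longrightarrow> 0 < f a \<Longrightarrow> f a < f i \<Longrightarrow> f i < f b \<Longrightarrow> cyclic n [a, i, b, r]"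
    and "i \<in> V" "i \<noteq> r"
  shows "finite (adm i) \<and> x_chord n i r = (\<Oplus>\<^bsub>polygon_algebra n\<^esub> w \<in> adm i. x_seq n w)"
  using assms(4,5)
proof (induction "card {c \<in> D. separates i c}" arbitrary: i rule: less_induct)
  case less
  interpret A: ring "polygon_algebra n" by (rule ring_polygon_algebra)
  have finD: "finite D" using D_subset V by (auto intro: finite_subset)
  have closed: "x_seq n \<in> S \<rightarrow> carrier (polygon_algebra n)" if "S \<subseteq> adm v" for S v
    using that D by (auto simp: adm_def intro!: x_seq_carrier)
  show ?case
  proof (cases "(i, r) \<in> D")
    case True
    then show ?thesis
      using D by (auto simp: adm_base A.finsum_insert x_chord_carrier)
  next
    case False
    obtain a b where T: "(a, b) \<in> D" "(i, a) \<in> D" "(i, b) \<in> D" "separates i (a, b)" "f a < f b"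
      "\<And>c. c \<in> D \<Longrightarrow> separates i c \<Longrightarrow> width (a, b) \<le> width c"
      using obtain_triangle[OF less.prems False] by metis
    interpret T: first_triangle V f r D i a b
      by unfold_locales (use T in auto)
    interpret T': first_triangle V f r D i b a by (rule T.swap)
    have abV: "a \<in> V" "b \<in> V" using D_V[OF T(1)] by auto
    have IH: "finite (adm v)" "x_chord n v r = (\<Oplus>\<^bsub>polygon_algebra n\<^esub> w \<in> adm v. x_seq n w)"
      if "v = a \<or> v = b" for v
      using less.hyps[of v] that T.crossing_decreases[OF finD] T'.crossing_decreases[OF finD]
        abV T.vertices_distinct by auto
    \<comment> \<open>Stated for \<open>u\<close> and \<open>v\<close> so that it covers both
      summands of the exchange relation.\<close>
    have half: "(\<Oplus>\<^bsub>polygon_algebra n\<^esub> w \<in> reroute i u ` adm v. x_seq n w) =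
        x_chord n i u \<otimes>\<^bsub>polygon_algebra n\<^esub> x_chord_inv n v u \<otimes>\<^bsub>polygon_algebra n\<^esub> x_chord n v r"
      if T: "first_triangle V f r D i u v" and v: "v = a \<or> v = b" for u v
    proof -
      interpret U: first_triangle V f r D i u v by (rule T)
      have ch: "(i, u) \<in> chords n" "(v, u) \<in> chords n" using U.ab U.ia sym D by auto
      have "(\<Oplus>\<^bsub>polygon_algebra n\<^esub> w \<in> reroute i u ` adm v. x_seq n w)
          = (\<Oplus>\<^bsub>polygon_algebra n\<^esub> w \<in> adm v. x_seq n (reroute i u w))"
        using U.reroute_adm by (intro A.finsum_reindex U.reroute_inj closed[of _ i]) auto
      also have "\<dots> = (\<Oplus>\<^bsub>polygon_algebra n\<^esub> w \<in> adm v.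
          x_chord n i u \<otimes>\<^bsub>polygon_algebra n\<^esub> x_chord_inv n v u \<otimes>\<^bsub>polygon_algebra n\<^esub> x_seq n w)"
        using x_seq_reroute[OF T D] closed[of "adm v" v] ch
        by (intro A.finsum_cong') (auto intro!: A.m_closed x_chord_carrier x_chord_inv_carrier)
      also have "\<dots> = x_chord n i u \<otimes>\<^bsub>polygon_algebra n\<^esub> x_chord_inv n v u \<otimes>\<^bsub>polygon_algebra n\<^esub>
          (\<Oplus>\<^bsub>polygon_algebra n\<^esub> w \<in> adm v. x_seq n w)"
        using IH(1)[OF v] closed[of "adm v" v] ch
        by (intro A.finsum_rdistr[symmetric]) (auto intro!: x_chord_carrier x_chord_inv_carrier)
      finally show ?thesis using IH(2)[OF v] by simp
    qed
    have fin: "finite (adm i)" unfolding T.adm_step using IH(1) by blast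
    have C: "x_chord n i a \<otimes>\<^bsub>polygon_algebra n\<^esub> x_chord_inv n b a \<otimes>\<^bsub>polygon_algebra n\<^esub> x_chord n b r
        \<in> carrier (polygon_algebra n)"
      "x_chord n i b \<otimes>\<^bsub>polygon_algebra n\<^esub> x_chord_inv n a b \<otimes>\<^bsub>polygon_algebra n\<^esub> x_chord n a r
        \<in> carrier (polygon_algebra n)"
      using half[OF T.first_triangle_axioms] half[OF T.swap]
        A.finsum_closed closed[of "reroute i a ` adm b" i] closed[of "reroute i b ` adm a" i]
        T.adm_step by (metis Un_upper1 Un_upper2)+
    \<comment> \<open>Here the choice \<open>f a < f b\<close> enters: it fixes the cyclic order
      required by the exchange relation.\<close>
    have "cyclic n [a, i, b, r]"
      using T(4,5) abV less.prems by (intro cyc) (auto simp: separates_def)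
    then have "x_chord n i r =
        x_chord n i b \<otimes>\<^bsub>polygon_algebra n\<^esub> x_chord_inv n a b \<otimes>\<^bsub>polygon_algebra n\<^esub> x_chord n a r
        \<oplus>\<^bsub>polygon_algebra n\<^esub>
        x_chord n i a \<otimes>\<^bsub>polygon_algebra n\<^esub> x_chord_inv n b a \<otimes>\<^bsub>polygon_algebra n\<^esub> x_chord n b r"
      by (rule exchange)
    also have "\<dots> = (\<Oplus>\<^bsub>polygon_algebra n\<^esub> w \<in> reroute i a ` adm b. x_seq n w)
        \<oplus>\<^bsub>polygon_algebra n\<^esub> (\<Oplus>\<^bsub>polygon_algebra n\<^esub> w \<in> reroute i b ` adm a. x_seq n w)"
      using half[OF T.first_triangle_axioms] half[OF T.swap] C by (simp add: A.a_comm)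
    also have "\<dots> = (\<Oplus>\<^bsub>polygon_algebra n\<^esub> w \<in> adm i. x_seq n w)"
    proof -
      have "finite (reroute i a ` adm b)" "finite (reroute i b ` adm a)" using IH(1) by blast+
      moreover have "x_seq n \<in> reroute i a ` adm b \<rightarrow> carrier (polygon_algebra n)"
        "x_seq n \<in> reroute i b ` adm a \<rightarrow> carrier (polygon_algebra n)"
        using T.adm_step by (auto intro!: closed[of _ i])
      ultimately show ?thesis
        unfolding T.adm_step
        using A.finsum_Un_disjoint[OF _ _ T.adm_step_disjoint, of "x_seq n"] by simp
    qed
    finally show ?thesis using fin by blast
  qed
qed

section \<open>Cyclic order and geometric admissibility\<close>

text \<open>Rotations depend only on \<open>k\<close> modulo the length, so for three or four points
  the existential expands into a finite disjunction.\<close>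

lemma ex_sorted_rotation_iff:
  "(\<exists>k. sorted_wrt R (rotate k xs)) \<longleftrightarrow> (\<exists>k<length xs. sorted_wrt R (rotate k xs))"
  if "xs \<noteq> []"
proof
  assume "\<exists>k. sorted_wrt R (rotate k xs)"
  then obtain k where "sorted_wrt R (rotate k xs)" by blast
  then have "sorted_wrt R (rotate (k mod length xs) xs)" by (simp add: rotate_conv_mod[symmetric])
  then show "\<exists>k<length xs. sorted_wrt R (rotate k xs)"
    using that by (intro exI[of _ "k mod length xs"]) simp
qed blast

lemma cyclic3_iff:
  "cyclic n [a, b, c] \<longleftrightarrow> {a, b, c} \<subseteq> {1..n} \<and> (a < b \<and> b < c \<or> b < c \<and> c < a \<or> c < a \<and> a < b)"
proof -
  have "(\<exists>k. sorted_wrt (<) (rotate k [a, b, c])) \<longleftrightarrow>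
      a < b \<and> b < c \<or> b < c \<and> c < a \<or> c < a \<and> a < b"
    unfolding ex_sorted_rotation_iff[OF list.distinct(2)]
    by (simp add: less_Suc_eq ex_disj_distrib conj_disj_distribR) linarith
  moreover have "distinct [a, b, c]" if "a < b \<and> b < c \<or> b < c \<and> c < a \<or> c < a \<and> a < b"
    using that by auto
  ultimately show ?thesis unfolding cyclic_def by auto
qed

lemma cyclic4_iff:
  "cyclic n [a, b, c, d] \<longleftrightarrow> {a, b, c, d} \<subseteq> {1..n} \<and>
    (a < b \<and> b < c \<and> c < d \<or> b < c \<and> c < d \<and> d < a \<or> c < d \<and> d < a \<and> a < b \<or> d < a \<and> a < b \<and> b < c)"
proof -
  let ?o = "a < b \<and> b < c \<and> c < d \<or> b < c \<and> c < d \<and> d < a \<or> c < d \<and> d < a \<and> a < b \<or> d < a \<and> a < b \<and> b < c"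
  have "(\<exists>k. sorted_wrt (<) (rotate k [a, b, c, d])) \<longleftrightarrow> ?o"
    unfolding ex_sorted_rotation_iff[OF list.distinct(2)]
    by (simp add: less_Suc_eq ex_disj_distrib conj_disj_distribR) linarith
  moreover have "distinct [a, b, c, d]" if ?o
    using that by (elim disjE conjE) simp_all
  ultimately show ?thesis unfolding cyclic_def by (simp only:) auto
qed

text \<open>The number of sides walked counterclockwise from \<open>r\<close> to \<open>x\<close>;
  the second branch wraps around past \<open>n\<close>. For \<open>r\<close> in
  \<open>{1..n}\<close> no subtraction truncates.\<close>

definition rank_from :: "nat \<Rightarrow> nat \<Rightarrow> nat \<Rightarrow> nat" where
  "rank_from n r x = (if r \<le> x then x - r else x + n - r)"

lemma cyclic3_of_rank:
  assumes "{a, b, c, r} \<subseteq> {1..n}" "rank_from n r a < rank_from n r b" "rank_from n r b < rank_from n r c"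
  shows "cyclic n [a, b, c]"
  using assms unfolding cyclic3_iff rank_from_def by (auto split: if_splits)

text \<open>Starting the numbering at \<open>r\<close> shifts the labels cyclically, which preserves
  cyclic order; crossing can thus be read off from ranks.\<close>

lemma cyclic4_rank_iff:
  assumes "{a, b, c, d, r} \<subseteq> {1..n}"
  shows "cyclic n [a, b, c, d] \<longleftrightarrow> (let f = rank_from n r in
    f a < f b \<and> f b < f c \<and> f c < f d \<or> f b < f c \<and> f c < f d \<and> f d < f a \<or>
    f c < f d \<and> f d < f a \<and> f a < f b \<or> f d < f a \<and> f a < f b \<and> f b < f c)"
proof -
  have mono: "rank_from n r x < rank_from n r y \<longleftrightarrow>
      (if r \<le> x then r \<le> y \<longrightarrow> x < y else \<not> r \<le> y \<and> x < y)"
    if "x \<in> {1..n}" "y \<in> {1..n}" for x y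
    using that assms by (auto simp: rank_from_def)
  show ?thesis
    using assms unfolding cyclic4_iff Let_def by (simp add: mono) linarith
qed

lemma inj_on_rank_from: "r \<in> {1..n} \<Longrightarrow> inj_on (rank_from n r) {1..n}"
  by (auto simp: inj_on_def rank_from_def split: if_splits)

lemma triangulation_memI:
  assumes "triangulation n \<Delta>" "e \<in> chords n"
    and "\<And>d. d \<in> \<Delta> \<Longrightarrow> \<not> crosses n d e \<and> \<not> crosses n e d"
  shows "e \<in> \<Delta>"
proof -
  have "\<not> crosses n e e" by (auto simp: crosses_def cyclic_def)
  then have "crossing_free n (insert e \<Delta>)"
    using assms by (auto simp: triangulation_def crossing_free_def)
  then have "insert e \<Delta> = \<Delta>" using assms(1) by (auto simp: triangulation_def)
  then show ?thesis by blast
qed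

text \<open>\<open>crosses\<close> depends on directions: reversing one chord turns
  \<open>crosses n c d\<close> into \<open>crosses n d c\<close>, by rotation of the four points.
  Forbidding both is invariant under reversal, and maximality does the rest.\<close>

lemma triangulation_sym:
  assumes T: "triangulation n \<Delta>" and "(a, b) \<in> \<Delta>"
  shows "(b, a) \<in> \<Delta>"
proof (rule triangulation_memI[OF T])
  have "(a, b) \<in> chords n" using assms by (auto simp: triangulation_def crossing_free_def)
  then show "(b, a) \<in> chords n" by (auto simp: chords_def)
  fix d assume "d \<in> \<Delta>"
  then have "\<not> crosses n d (a, b)" "\<not> crosses n (a, b) d"
    using assms by (auto simp: triangulation_def crossing_free_def)
  then show "\<not> crosses n d (b, a) \<and> \<not> crosses n (b, a) d"
    unfolding crosses_def cyclic4_iff by auto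
qed

lemma polygon_triangulation_rank:
  assumes T: "triangulation n \<Delta>" and P: "convex_ngon n P" and r: "r \<in> {1..n}"
  shows "polygon_triangulation {1..n} (rank_from n r) r \<Delta> P"
proof
  let ?f = "rank_from n r"
  have sub: "\<Delta> \<subseteq> chords n" and free: "\<And>c d. c \<in> \<Delta> \<Longrightarrow> d \<in> \<Delta> \<Longrightarrow> \<not> crosses n c d"
    using T by (auto simp: triangulation_def crossing_free_def)
  have V: "a \<in> {1..n} \<and> b \<in> {1..n} \<and> a \<noteq> b" if "(a, b) \<in> \<Delta>" for a b
    using that sub by (auto simp: chords_def)
  show "inj_on ?f {1..n}" by (rule inj_on_rank_from[OF r])
  show "r \<in> {1..n}" "?f r = 0" using r by (auto simp: rank_from_def)
  show "\<Delta> \<subseteq> {1..n} \<times> {1..n}" using V by auto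
  show "a \<noteq> b" if "(a, b) \<in> \<Delta>" for a b using V[OF that] by simp
  show "(b, a) \<in> \<Delta>" if "(a, b) \<in> \<Delta>" for a b using triangulation_sym[OF T that] .
  show False if "(a, b) \<in> \<Delta>" "(c, d) \<in> \<Delta>" "?f a < ?f c" "?f c < ?f b" "?f b < ?f d" for a b c d
  proof -
    have "cyclic n [a, c, b, d]"
      using that V[OF that(1)] V[OF that(2)] r by (subst cyclic4_rank_iff[of _ _ _ _ r]) auto
    then show False using free[OF that(1,2)] by (simp add: crosses_def)
  qed
  show "(a, b) \<in> \<Delta>" if ab: "a \<in> {1..n}" "b \<in> {1..n}" "?f a < ?f b"
    and no: "\<And>c d. (c, d) \<in> \<Delta> \<Longrightarrow> ?f a < ?f c \<Longrightarrow> ?f c < ?f b \<Longrightarrow> ?f d < ?f a \<or> ?f b < ?f d \<Longrightarrow> False"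
    for a b
  proof (rule triangulation_memI[OF T])
    show "(a, b) \<in> chords n" using ab by (auto simp: chords_def)
    fix d assume d: "d \<in> \<Delta>"
    obtain u v where uv: "d = (u, v)" by fastforce
    have D: "(u, v) \<in> \<Delta>" "(v, u) \<in> \<Delta>" using d uv triangulation_sym[OF T] by auto
    have sub': "{u, a, v, b, r} \<subseteq> {1..n}" "{a, u, b, v, r} \<subseteq> {1..n}" using ab V[OF D(1)] r by auto
    have "\<not> (?f a < ?f u \<and> ?f u < ?f b \<and> (?f v < ?f a \<or> ?f b < ?f v))"
      "\<not> (?f a < ?f v \<and> ?f v < ?f b \<and> (?f u < ?f a \<or> ?f b < ?f u))"
      using no[OF D(1)] no[OF D(2)] by blast+
    then show "\<not> crosses n d (a, b) \<and> \<not> crosses n (a, b) d"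
      using ab(3)
      unfolding crosses_def uv fst_conv snd_conv cyclic4_rank_iff[OF sub'(1)]
        cyclic4_rank_iff[OF sub'(2)] Let_def
      by (intro conjI notI; elim disjE conjE) simp_all
  qed
  show "0 < orient (P a) (P b) (P c)"
    if "a \<in> {1..n}" "b \<in> {1..n}" "c \<in> {1..n}" "?f a < ?f b" "?f b < ?f c" for a b c
    using P cyclic3_of_rank[of a b c r n] that r by (auto simp: convex_ngon_def orient_def)
qed

context polygon_triangulation
begin

text \<open>Position \<open>s\<close>, counted from 1, becomes edge \<open>s - 1\<close> of the edge
  list; after this change of indices \<open>geometric_iff_adm\<close> applies.\<close>

lemma Adm_eq_adm:
  assumes V: "V = {1..n}" and i: "i \<in> V" "i \<noteq> r"
  shows "Adm n P D i r = adm i"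
proof -
  have "w \<in> Adm n P D i r \<longleftrightarrow> hd w = i \<and> last w = r \<and> set (edges w) \<subseteq> D \<and>
      alternating (meets i) w \<and> sorted_wrt (before i) (edges w)" (is "_ \<longleftrightarrow> ?geo") for w
  proof (cases "\<exists>m\<ge>1. length w = 2 * m")
    case False
    then have "w \<notin> Adm n P D i r" by (auto simp: Adm_def)
    moreover have "\<not> alternating (meets i) w" using False unfolding alternating_iff_nth by blast
    ultimately show ?thesis by blast
  next
    case True
    then obtain m where m: "m \<ge> 1" "length w = 2 * m" by blast
    have len: "length (edges w) = 2 * m - 1" using m by simp
    have edge: "edges w ! k = (w ! k, w ! Suc k)" if "k < 2 * m - 1" for k
      using that m by (simp add: nth_tl)
    have shift: "(\<forall>s\<in>{1..2 * m - 1}. R s) \<longleftrightarrow> (\<forall>k<2 * m - 1. R (Suc k))" for R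
      unfolding image_Suc_lessThan[symmetric] by auto
    have path: "(\<forall>s\<in>{1..2 * m - 1}. (w ! (s - 1), w ! s) \<in> D) \<longleftrightarrow> set (edges w) \<subseteq> D"
    proof -
      have "set (edges w) \<subseteq> D \<longleftrightarrow> (\<forall>k<2 * m - 1. (w ! k, w ! Suc k) \<in> D)"
        unfolding subset_iff all_set_conv_all_nth Ball_def[symmetric] len using edge by auto
      then show ?thesis unfolding shift by simp
    qed
    \<comment> \<open>As \<open>m \<ge> 1\<close>, every vertex lies on some edge, so the edge
      condition already bounds the vertices.\<close>
    have vertices: "set w \<subseteq> {1..n}" if "set (edges w) \<subseteq> D"
    proof
      fix x assume "x \<in> set w"
      then obtain k where k: "k < 2 * m" "x = w ! k" using m by (auto simp: in_set_conv_nth)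
      have D: "(w ! l, w ! Suc l) \<in> V \<times> V" if "l < 2 * m - 1" for l
        using nth_mem[of l "edges w"] edge[OF that] len that \<open>set (edges w) \<subseteq> D\<close> D_subset by auto
      show "x \<in> {1..n}"
      proof (cases k)
        case 0
        then show ?thesis using D[of 0] m k V by auto
      next
        case (Suc l)
        then show ?thesis using D[of l] k V by auto
      qed
    qed
    have even: "(\<forall>s\<in>{1..m - 1}. chord P (w ! (2 * s - 1)) (w ! (2 * s)) \<inter> chord P i r \<noteq> {}) \<longleftrightarrow>
        alternating (meets i) w"
      unfolding alternating_iff_nth meets_def fst_conv snd_conv using m by auto
    have order: "(\<forall>k\<in>{1..2 * m - 1}. \<forall>l\<in>{1..2 * m - 1}. k < l \<longrightarrow>
        (\<forall>p \<in> chord P (w ! (k - 1)) (w ! k) \<inter> chord P i r.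
         \<forall>q \<in> chord P (w ! (l - 1)) (w ! l) \<inter> chord P i r. dist (P i) p < dist (P i) q)) \<longleftrightarrow>
        sorted_wrt (before i) (edges w)" (is "?L \<longleftrightarrow> _")
    proof -
      have "?L \<longleftrightarrow> (\<forall>k<2 * m - 1. \<forall>l<2 * m - 1. k < l \<longrightarrow>
          before i (w ! k, w ! Suc k) (w ! l, w ! Suc l))"
        unfolding shift before_def by simp
      also have "\<dots> \<longleftrightarrow> sorted_wrt (before i) (edges w)"
        unfolding sorted_wrt_iff_nth_less len using edge by (auto simp del: nth_zip)
      finally show ?thesis .
    qed
    have "w \<noteq> []" using m by auto
    then have ends: "hd w = w ! 0" "last w = w ! (2 * m - 1)"
      using m by (simp_all add: hd_conv_nth last_conv_nth)
    have unique: "(\<exists>m'\<ge>1. length w = 2 * m' \<and> R m') \<longleftrightarrow> R m" for R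
      using m by auto
    show ?thesis
      unfolding Adm_def mem_Collect_eq unique path even order ends using vertices by blast
  qed
  then show ?thesis using geometric_iff_adm[OF i] by blast
qed

end

theorem theorem2p10:
  fixes n i j :: nat and P :: "nat \<Rightarrow> complex" and \<Delta> :: "(nat \<times> nat) set"
  assumes "n \<ge> 3"
    and "convex_ngon n P"
    and "triangulation n \<Delta>"
    and "i \<in> {1..n}" and "j \<in> {1..n}" and "i \<noteq> j"
  shows "x_chord n i j = (\<Oplus>\<^bsub>polygon_algebra n\<^esub> w \<in> Adm n P \<Delta> i j. x_seq n w)"
proof -
  interpret polygon_triangulation "{1..n}" "rank_from n j" j \<Delta> P
    using assms by (intro polygon_triangulation_rank)
  have "\<Delta> \<subseteq> chords n" using assms(3) by (auto simp: triangulation_def crossing_free_def)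
  moreover have "cyclic n [a, v, b, j]"
    if "{a, v, b} \<subseteq> {1..n}" "0 < rank_from n j a" "rank_from n j a < rank_from n j v"
      "rank_from n j v < rank_from n j b" for a v b
    using that assms(5) root by (subst cyclic4_rank_iff[of _ _ _ _ j]) (auto simp: Let_def)
  ultimately show ?thesis
    using laurent_expansion[of n i] Adm_eq_adm[of n i] assms(4,6) by auto
qed

end
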